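(* Let $m\ge 0$. Let $A_1$ be a non-symmetric homogeneous $m$-quasiinvariant of degree $3m+1$ of the form $A_1=\sum_{0\le i\le j\le m}C_{[i,j]}x_1^{3m+1-i-j}m_{[i,j]}(x_2,x_3)$, and let $A_2$ be a non-symmetric homogeneous $m$-quasiinvariant of degree $3m+2$ of the form $A_2=\sum_{0\le i\le j\le m}\tilde C_{[i,j]}x_1^{3m+2-i-j}m_{[i,j]}(x_2,x_3)$, such that for each $r\in\{1,2\}$: $s_{23}(A_r)=A_r$, and the images of $A_r$ and $s_{12}(A_r)$ in $QI_m/\langle e_1,e_2,e_3\rangle$ are linearly independent and linearly independent of the image of $\Delta(x)^{2m+1}$. Then the images of \[ \{1,\ A_1,\ s_{12}(A_1),\ A_2,\ s_{12}(A_2),\ \Delta(x)^{2m+1}\} \] form a basis of the $\mathbb{Q}$-vector space $QI_m/\langle e_1,e_2,e_3\rangle$.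
   Context: $s_{ij}$ denotes the transposition exchanging $x_i$ and $x_j$, acting on $\mathbb{Q}[x_1,x_2,x_3]$ by permuting variables. For an integer $m\ge0$, $P$ is $m$-quasiinvariant if $(x_i-x_j)^{2m+1}$ divides $P-s_{ij}P$ for all $1\le i<j\le 3$; these form a ring $QI_m$. $e_1,e_2,e_3$ are the elementary symmetric polynomials in $x_1,x_2,x_3$, and $QI_m/\langle e_1,e_2,e_3\rangle$ is the quotient of $QI_m$ by the ideal of $QI_m$ generated by $e_1,e_2,e_3$. $\Delta(x)=(x_1-x_2)(x_1-x_3)(x_2-x_3)$. For $i\ne j$, $m_{[i,j]}(x_2,x_3)=x_2^ix_3^j+x_2^jx_3^i$, and $m_{[i,i]}(x_2,x_3)=x_2^ix_3^i$. *)

theory Defs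
  imports
    "HOL-Library.Poly_Mapping"
    "HOL-Library.Numeral_Type"
    "HOL-Combinatorics.Transposition"
    "HOL-Algebra.QuotRing"
    "HOL-Algebra.Embedded_Algebras"
begin

text \<open>
  The polynomial ring \<open>\<rat>[x\<^sub>1, x\<^sub>2, x\<^sub>3]\<close>: the variables are indexed by the three-element type \<open>3\<close>,
  whose elements are \<open>1\<close>, \<open>2\<close> and \<open>3 = 0\<close>; a monomial is its exponent function, and a polynomial
  maps monomials to coefficients.
\<close>

type_synonym mon3 = "3 \<Rightarrow>\<^sub>0 nat"
type_synonym poly3 = "mon3 \<Rightarrow>\<^sub>0 rat"

definition var :: "3 \<Rightarrow> poly3" where
  "var i = Poly_Mapping.single (Poly_Mapping.single i 1) 1"

definition const :: "rat \<Rightarrow> poly3" where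
  "const c = Poly_Mapping.single 0 c"

definition mdeg :: "mon3 \<Rightarrow> nat" where
  "mdeg u = (\<Sum>i\<in>UNIV. Poly_Mapping.lookup u i)"

definition homogeneous :: "nat \<Rightarrow> poly3 \<Rightarrow> bool" where
  "homogeneous d P \<longleftrightarrow> (\<forall>u\<in>Poly_Mapping.keys P. mdeg u = d)"

text \<open>
  \<open>map_key\<close> is precomposition: the coefficient of \<open>s i j P\<close> at a monomial \<open>u\<close> is the coefficient of
  \<open>P\<close> at \<open>u\<close> with the exponents of \<open>x\<^sub>i\<close> and \<open>x\<^sub>j\<close> exchanged.
\<close>

definition s :: "3 \<Rightarrow> 3 \<Rightarrow> poly3 \<Rightarrow> poly3" where
  "s i j P = Poly_Mapping.map_key (Poly_Mapping.map_key (Transposition.transpose i j)) P"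

definition symmetric :: "poly3 \<Rightarrow> bool" where
  "symmetric P \<longleftrightarrow> (\<forall>i j. s i j P = P)"

definition QI :: "nat \<Rightarrow> poly3 set" where
  "QI m = {P. \<forall>(i, j)\<in>{(1, 2), (1, 3), (2, 3)}. (var i - var j) ^ (2 * m + 1) dvd P - s i j P}"

definition QI_ring :: "nat \<Rightarrow> poly3 ring" where
  "QI_ring m = \<lparr>carrier = QI m, mult = (*), one = 1, zero = 0, add = (+)\<rparr>"

definition e1 :: poly3 where "e1 = var 1 + var 2 + var 3"
definition e2 :: poly3 where "e2 = var 1 * var 2 + var 1 * var 3 + var 2 * var 3"
definition e3 :: poly3 where "e3 = var 1 * var 2 * var 3"

definition \<Delta> :: poly3 where
  "\<Delta> = (var 1 - var 2) * (var 1 - var 3) * (var 2 - var 3)"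

definition msym :: "nat \<Rightarrow> nat \<Rightarrow> poly3" where
  "msym i j = (if i = j then var 2 ^ i * var 3 ^ i
               else var 2 ^ i * var 3 ^ j + var 2 ^ j * var 3 ^ i)"

definition e_ideal :: "nat \<Rightarrow> poly3 set" where
  "e_ideal m = Idl\<^bsub>QI_ring m\<^esub> {e1, e2, e3}"

definition QI_quot :: "nat \<Rightarrow> poly3 set ring" where
  "QI_quot m = QI_ring m Quot e_ideal m"

definition img :: "nat \<Rightarrow> poly3 \<Rightarrow> poly3 set" where
  "img m P = e_ideal m +>\<^bsub>QI_ring m\<^esub> P"

text \<open>
  The \<open>\<rat>\<close>-vector space structure of the quotient comes from the images of the constant polynomials;
  the scalar multiple of a class by \<open>c\<close> is its product with the class of \<open>const c\<close>. Linear
  independence and spans are those of the library for lists of ring elements, so that they refer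
  to families, and repeated elements make a family dependent.
\<close>

definition scalars :: "nat \<Rightarrow> poly3 set set" where
  "scalars m = img m ` range const"

definition lin_indep :: "nat \<Rightarrow> poly3 set list \<Rightarrow> bool" where
  "lin_indep m vs \<longleftrightarrow> ring.independent (QI_quot m) (scalars m) vs"

definition is_basis :: "nat \<Rightarrow> poly3 set list \<Rightarrow> bool" where
  "is_basis m vs \<longleftrightarrow>
     lin_indep m vs \<and> ring.Span (QI_quot m) (scalars m) vs = carrier (QI_quot m)"

text \<open>
  The library facts about \<open>ring.independent\<close> and \<open>ring.Span\<close> hold under the assumption that the
  structure is a ring; this is verified here for the quotient.
\<close>

lemma map_key_transpose_twice: "Poly_Mapping.map_key (Transposition.transpose i j) (Poly_Mapping.map_key (Transposition.transpose i j) u) = u"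
  by (subst map_key_compose) (auto simp: map_key_id comp_def)

lemma inj_map_key_transpose: "inj (Poly_Mapping.map_key (Transposition.transpose i j))"
  by (rule inj_on_inverseI[where g="Poly_Mapping.map_key (Transposition.transpose i j)"]) (simp add: map_key_transpose_twice)

lemma s_single: "s i j (Poly_Mapping.single u c) = Poly_Mapping.single (Poly_Mapping.map_key (Transposition.transpose i j) u) c"
  unfolding s_def
  using map_key_single[OF inj_map_key_transpose, of i j "Poly_Mapping.map_key (Transposition.transpose i j) u" c]
  by (simp add: map_key_transpose_twice)

lemma s_var: "s i j (var k) = var (Transposition.transpose i j k)"
  unfolding var_def s_single
  using map_key_single[of "Transposition.transpose i j" "Transposition.transpose i j k" "1::nat"] by simp

lemma s_const: "s i j (const c) = const c"
  by (simp add: const_def s_single map_key_zero)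

lemma s_add: "s i j (P + Q) = s i j P + s i j Q"
  unfolding s_def by (rule map_key_plus[OF inj_map_key_transpose])

lemma poly3_induct: "(\<And>u c. R (Poly_Mapping.single u c)) \<Longrightarrow> (\<And>P Q. R P \<Longrightarrow> R Q \<Longrightarrow> R (P + Q)) \<Longrightarrow> R (P::poly3)"
proof (induction P rule: update_induct)
  case const
  then show ?case by (metis single_zero)
next
  case (update f a b)
  have "Poly_Mapping.update a b f = f + Poly_Mapping.single a b"
    using update(1) by (intro poly_mapping_eqI) (auto simp: lookup_update lookup_add lookup_single in_keys_iff when_def)
  then show ?case using update by simp
qed

lemma s_mult: "s i j (P * Q) = s i j P * s i j Q"
proof (induction P rule: poly3_induct)
  case (1 u c)
  show ?case
    by (induction Q rule: poly3_induct) (simp_all add: mult_single s_single map_key_plus distrib_left s_add)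
next
  case (2 P Q) then show ?case by (simp add: distrib_right s_add)
qed

lemma s_1: "s i j 1 = 1" using s_const[of i j 1] by (simp add: const_def)
lemma s_uminus: "s i j (- P) = - s i j P"
  using s_add[of i j P "-P"] s_const[of i j 0] by (simp add: const_def eq_neg_iff_add_eq_0 add.commute)
lemma s_0: "s i j 0 = 0" using s_const[of i j 0] by (simp add: const_def)

lemma cring_QI_ring: "cring (QI_ring m)"
proof -
  have add: "d dvd (P - P') \<Longrightarrow> d dvd (Q - Q') \<Longrightarrow> d dvd (P + Q) - (P' + Q')" for d P P' Q Q' :: poly3
    by (simp add: add_diff_add)
  have mult: "d dvd (P * Q) - (P' * Q')" if "d dvd (P - P')" "d dvd (Q - Q')" for d P P' Q Q' :: poly3
  proof -
    have "P * Q - P' * Q' = (P - P') * Q + P' * (Q - Q')" by (simp add: algebra_simps)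
    then show ?thesis using that by simp
  qed
  have neg: "d dvd P - P' \<Longrightarrow> d dvd P' - P" for d P P' :: poly3
    by (metis dvd_minus_iff minus_diff_eq)
  have cl: "P \<in> QI m \<Longrightarrow> Q \<in> QI m \<Longrightarrow> P + Q \<in> QI m \<and> P * Q \<in> QI m" "0 \<in> QI m" "1 \<in> QI m" "P \<in> QI m \<Longrightarrow> - P \<in> QI m" for P Q
    by (simp_all add: QI_def s_add s_mult s_1 s_0 s_uminus add mult) (simp add: neg)
  show ?thesis
    by (rule cringI; (rule abelian_groupI comm_monoidI)?)
       (use cl in \<open>auto simp: QI_ring_def algebra_simps intro!: bexI[of _ "- _"]\<close>)
qed

lemma elementary_in_QI: "{e1, e2, e3} \<subseteq> QI m"
  by (simp add: QI_def e1_def e2_def e3_def s_add s_mult s_var transpose_def algebra_simps)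

lemma ring_QI_quot: "ring (QI_quot m)"
  unfolding QI_quot_def e_ideal_def
proof (rule ideal.quotient_is_ring, rule ring.genideal_ideal)
  show "ring (QI_ring m)" using cring_QI_ring by (simp add: cring_def)
  show "{e1, e2, e3} \<subseteq> carrier (QI_ring m)" using elementary_in_QI by (simp add: QI_ring_def)
qed

end

theory Submission
  imports Defs "HOL-Computational_Algebra.Polynomial"
begin

text \<open>
  Over the ring of symmetric polynomials, \<open>QI\<^sub>m\<close> splits into its symmetric part, its alternating part
  (the multiples of \<open>\<Delta>\<^bsup>2m+1\<^esup>\<close>) and its standard part, which is governed by the module of \<open>s\<^sub>2\<^sub>3\<close>-invariant
  elements \<open>P\<close> with \<open>P + s\<^sub>1\<^sub>2 P + s\<^sub>1\<^sub>3 P = 0\<close>. For two such elements the determinant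
  \<open>P (s\<^sub>1\<^sub>2 Q) - Q (s\<^sub>1\<^sub>2 P)\<close> is alternating and hence a symmetric multiple of \<open>\<Delta>\<^bsup>2m+1\<^esup>\<close>; if it is a nonzero
  constant multiple, Cramer's rule shows that \<open>P, Q\<close> is a basis of the module. The integrals of
  \<open>t\<^sup>r \<Prod>(t - x\<^sub>k)\<^sup>m dt\<close> between the \<open>x\<^sub>k\<close>, for \<open>r = 0, 1\<close>, give such a pair in the degrees \<open>3m + 1\<close> and
  \<open>3m + 2\<close>. Comparing degrees, the standard parts of \<open>A\<^sub>1\<close> and \<open>A\<^sub>2\<close> are another such pair as soon as
  \<open>A\<^sub>1\<close> and \<open>A\<^sub>2\<close> are nonzero modulo \<open>e\<^sub>1, e\<^sub>2, e\<^sub>3\<close>.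
\<close>

section \<open>Evaluation homomorphisms\<close>

lemma UNIV_3: "(UNIV :: 3 set) = {1, 2, 3}"
  by (rule sym, rule card_seteq) auto

lemma sum_UNIV_3: "sum f (UNIV :: 3 set) = f 1 + f 2 + f 3"
  by (subst UNIV_3) (simp add: add.assoc)

lemma prod_UNIV_3: "prod f (UNIV :: 3 set) = f 1 * f 2 * f 3"
  by (subst UNIV_3) (simp add: mult.assoc)

lemma const_0 [simp]: "const 0 = 0"
  and const_1 [simp]: "const 1 = 1"
  and const_add: "const (a + b) = const a + const b"
  and const_mult: "const (a * b) = const a * const b"
  by (simp_all add: const_def single_add mult_single)

lemma const_uminus: "const (- a) = - const a"
  by (simp add: const_def single_uminus)

lemma const_diff: "const (a - b) = const a - const b"
  by (simp add: const_def single_diff)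

lemma const_eq_0_iff [simp]: "const c = 0 \<longleftrightarrow> c = 0"
  by (metis const_def lookup_single_eq single_zero)

lemma const_numeral: "const (numeral k) = numeral k"
  by (simp add: const_def)

lemma const_inverse_mult: "c \<noteq> 0 \<Longrightarrow> const (1 / c) * (const c * P) = P"
  by (simp add: const_mult[symmetric] mult.assoc[symmetric])

lemma var_power: "var i ^ n = Poly_Mapping.single (Poly_Mapping.single i n) 1"
  by (induction n) (simp_all add: var_def mult_single single_add[symmetric])

lemma single_eq_const_mult_prod_var:
  "Poly_Mapping.single u c = const c * (\<Prod>i\<in>UNIV. var i ^ Poly_Mapping.lookup u i)"
proof -
  have "(\<Prod>i\<in>UNIV. var i ^ Poly_Mapping.lookup u i) =
      Poly_Mapping.single (\<Sum>i\<in>UNIV. Poly_Mapping.single i (Poly_Mapping.lookup u i)) 1"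
    by (simp add: var_power sum_UNIV_3 prod_UNIV_3 mult_single)
  also have "(\<Sum>i\<in>UNIV. Poly_Mapping.single i (Poly_Mapping.lookup u i)) = u"
    by (rule poly_mapping_eqI) (simp add: lookup_sum lookup_single when_def)
  finally show ?thesis
    by (simp add: const_def mult_single)
qed

text \<open>The substitution homomorphism with \<open>h\<close> acting on coefficients. The target
  ring is left open because polynomials, polynomials over polynomials and reals all occur as
  values.\<close>

definition ev :: "(rat \<Rightarrow> 'b) \<Rightarrow> (3 \<Rightarrow> 'b) \<Rightarrow> poly3 \<Rightarrow> 'b::comm_ring_1" where
  "ev h x P = (\<Sum>u\<in>Poly_Mapping.keys P.
     h (Poly_Mapping.lookup P u) * (\<Prod>i\<in>UNIV. x i ^ Poly_Mapping.lookup u i))"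

definition ring_hom1 :: "('a::comm_ring_1 \<Rightarrow> 'b::comm_ring_1) \<Rightarrow> bool" where
  "ring_hom1 f \<longleftrightarrow> f 1 = 1 \<and> (\<forall>x y. f (x + y) = f x + f y) \<and> (\<forall>x y. f (x * y) = f x * f y)"

lemma ring_hom1D:
  assumes "ring_hom1 f"
  shows "f 1 = 1" "f (x + y) = f x + f y" "f (x * y) = f x * f y"
    "f 0 = 0" "f (- x) = - f x" "f (x - y) = f x - f y" "f (x ^ n) = f x ^ n"
    "f (of_nat n) = of_nat n"
proof -
  show *: "f 1 = 1" "f (x + y) = f x + f y" "f (x * y) = f x * f y" for x y
    using assms by (auto simp: ring_hom1_def)
  show 0: "f 0 = 0" using *(2)[of 0 0] by simp
  show neg: "f (- x) = - f x" for x
    using *(2)[of x "-x"] 0 by (simp add: eq_neg_iff_add_eq_0 add.commute)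
  show "f (x - y) = f x - f y" using *(2)[of x "-y"] neg by simp
  show "f (x ^ n) = f x ^ n" by (induction n) (simp_all add: *)
  show "f (of_nat n) = of_nat n" by (induction n) (simp_all add: * 0)
qed

lemma ring_hom1_sum: "ring_hom1 f \<Longrightarrow> f (sum g A) = (\<Sum>x\<in>A. f (g x))"
  by (induction A rule: infinite_finite_induct) (simp_all add: ring_hom1D)

lemma ring_hom1_prod: "ring_hom1 f \<Longrightarrow> f (prod g A) = (\<Prod>x\<in>A. f (g x))"
  by (induction A rule: infinite_finite_induct) (simp_all add: ring_hom1D)

lemma ring_hom1_const: "ring_hom1 const"
  by (simp add: ring_hom1_def const_add const_mult)

lemma ring_hom1_comp: "ring_hom1 f \<Longrightarrow> ring_hom1 g \<Longrightarrow> ring_hom1 (\<lambda>x. f (g x))"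
  by (simp add: ring_hom1_def)

lemma ring_hom1_s: "ring_hom1 (s i j)"
  by (simp add: ring_hom1_def s_1 s_add s_mult)

lemmas s_diff = ring_hom1D(6)[OF ring_hom1_s]
  and s_power = ring_hom1D(7)[OF ring_hom1_s]

lemma s_numeral: "s i j (numeral k) = numeral k"
  using s_const[of i j "numeral k"] by (simp add: const_numeral)

context
  fixes h :: "rat \<Rightarrow> 'b::comm_ring_1"
  assumes h: "ring_hom1 h"
begin

lemma ev_single: "ev h x (Poly_Mapping.single u c) = h c * (\<Prod>i\<in>UNIV. x i ^ Poly_Mapping.lookup u i)"
  by (simp add: ev_def ring_hom1D[OF h])

lemma ev_add: "ev h x (P + Q) = ev h x P + ev h x Q"
proof -
  let ?t = "\<lambda>u. \<Prod>i\<in>UNIV. x i ^ Poly_Mapping.lookup u i"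
  let ?A = "Poly_Mapping.keys P \<union> Poly_Mapping.keys Q"
  have *: "ev h x R = (\<Sum>u\<in>?A. h (Poly_Mapping.lookup R u) * ?t u)" if "Poly_Mapping.keys R \<subseteq> ?A" for R
    unfolding ev_def using that
    by (intro sum.mono_neutral_left) (auto simp: in_keys_iff ring_hom1D[OF h])
  have "Poly_Mapping.keys (P + Q) \<subseteq> ?A" by (rule keys_add)
  then show ?thesis
    by (simp add: * lookup_add ring_hom1D[OF h] distrib_right sum.distrib)
qed

lemma ev_mult: "ev h x (P * Q) = ev h x P * ev h x Q"
proof (induction P rule: poly3_induct)
  case (1 u c)
  show ?case
  proof (induction Q rule: poly3_induct)
    case (1 v d)
    show ?case
      by (simp add: mult_single ev_single lookup_add power_add prod.distrib ring_hom1D(3)[OF h] ac_simps)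
  next
    case (2 P Q)
    then show ?case by (simp add: distrib_left ev_add)
  qed
next
  case (2 P Q)
  then show ?case by (simp add: distrib_right ev_add)
qed

lemma ev_const: "ev h x (const c) = h c"
  by (simp add: const_def ev_single)

lemma ev_var: "ev h x (var i) = x i"
proof -
  have "x k ^ (Poly_Mapping.lookup (Poly_Mapping.single i 1) k) = (if k = i then x i else 1)" for k
    by (auto simp: lookup_single)
  then show ?thesis
    by (simp add: var_def ev_single ring_hom1D[OF h])
qed

lemma ring_hom1_ev: "ring_hom1 (ev h x)"
  using ev_const[of x 1] by (simp add: ring_hom1_def ev_add ev_mult ring_hom1D[OF h])

end

text \<open>Constants and variables generate the polynomial ring. Identities about the group action
  and the grading are thereby reduced to a check on generators.\<close>

lemma ring_hom1_eqI:
  assumes "ring_hom1 f" "ring_hom1 g" "\<And>c. f (const c) = g (const c)" "\<And>i. f (var i) = g (var i)"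
  shows "f P = g P"
  by (induction P rule: poly3_induct)
    (simp_all add: assms single_eq_const_mult_prod_var ring_hom1D[OF assms(1)] ring_hom1D[OF assms(2)]
      ring_hom1_prod[OF assms(1)] ring_hom1_prod[OF assms(2)])

section \<open>Graded polynomials\<close>

text \<open>The coefficient of \<open>z^d\<close> in the image is the degree \<open>d\<close> part
  of the argument.\<close>

definition grading :: "poly3 \<Rightarrow> poly3 poly" where
  "grading = ev (\<lambda>c. [:const c:]) (\<lambda>i. monom (var i) 1)"

text \<open>Homogeneity phrased through the homomorphism \<open>x\<^sub>i \<mapsto> x\<^sub>i z\<close>, which makes it pass to factors.\<close>

definition graded :: "nat \<Rightarrow> poly3 \<Rightarrow> bool" where
  "graded d P \<longleftrightarrow> grading P = monom P d"

lemma ring_hom1_const_poly: "ring_hom1 (\<lambda>c. [:const c:])"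
  by (simp add: ring_hom1_def const_add const_mult one_pCons)

lemma ring_hom1_grading: "ring_hom1 grading"
  unfolding grading_def by (rule ring_hom1_ev) (rule ring_hom1_const_poly)

lemma grading_const: "grading (const c) = monom (const c) 0"
  unfolding grading_def ev_const[OF ring_hom1_const_poly] by (simp add: monom_0)

lemma grading_var: "grading (var i) = monom (var i) 1"
  unfolding grading_def ev_var[OF ring_hom1_const_poly] ..

lemma grading_single: "grading (Poly_Mapping.single u c) = monom (Poly_Mapping.single u c) (mdeg u)"
proof -
  have "(\<Prod>i\<in>UNIV. monom (var i) 1 ^ Poly_Mapping.lookup u i) =
      monom (\<Prod>i\<in>UNIV. var i ^ Poly_Mapping.lookup u i) (mdeg u)"
    by (simp add: monom_power sum_UNIV_3 prod_UNIV_3 mult_monom mdeg_def)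
  then show ?thesis
    unfolding grading_def ev_single[OF ring_hom1_const_poly]
    by (simp add: single_eq_const_mult_prod_var[of u c] smult_monom)
qed

lemma poly3_eq_sum_single:
  "P = (\<Sum>u\<in>Poly_Mapping.keys P. Poly_Mapping.single u (Poly_Mapping.lookup P u))" for P :: poly3
  by (rule poly_mapping_eqI) (auto simp: lookup_sum lookup_single when_def in_keys_iff)

lemma homogeneous_graded:
  assumes "homogeneous d P"
  shows "graded d P"
proof -
  have "grading P = (\<Sum>u\<in>Poly_Mapping.keys P. monom (Poly_Mapping.single u (Poly_Mapping.lookup P u)) (mdeg u))"
    by (subst poly3_eq_sum_single) (simp only: ring_hom1_sum[OF ring_hom1_grading] grading_single)
  also have "\<dots> = (\<Sum>u\<in>Poly_Mapping.keys P. monom (Poly_Mapping.single u (Poly_Mapping.lookup P u)) d)"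
    using assms by (intro sum.cong) (auto simp: homogeneous_def)
  also have "\<dots> = monom P d"
    by (subst (3) poly3_eq_sum_single) (simp add: monom_sum)
  finally show ?thesis by (simp add: graded_def)
qed

lemma graded_mult: "graded a P \<Longrightarrow> graded b Q \<Longrightarrow> graded (a + b) (P * Q)"
  by (simp add: graded_def ring_hom1D[OF ring_hom1_grading] mult_monom)

lemma graded_add: "graded d P \<Longrightarrow> graded d Q \<Longrightarrow> graded d (P + Q)"
  by (simp add: graded_def ring_hom1D[OF ring_hom1_grading] add_monom)

lemma graded_diff: "graded d P \<Longrightarrow> graded d Q \<Longrightarrow> graded d (P - Q)"
  by (simp add: graded_def ring_hom1D[OF ring_hom1_grading] diff_monom)

lemma graded_const: "graded 0 (const c)"
  by (simp add: graded_def grading_const)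

lemma graded_const_mult: "graded d P \<Longrightarrow> graded d (const c * P)"
  using graded_mult[OF graded_const] by fastforce

lemma graded_var: "graded 1 (var i)"
  by (simp add: graded_def grading_var)

lemma graded_power: "graded d P \<Longrightarrow> graded (d * n) (P ^ n)"
  by (simp add: graded_def ring_hom1D[OF ring_hom1_grading] monom_power)

text \<open>Multiplicativity gives \<open>P z^a * grading Q = P z^a * Q z^b\<close>, and the nonzero
  \<open>P z^a\<close> cancels in an integral domain.\<close>

lemma graded_cancel:
  assumes "graded a P" "graded (a + b) (P * Q)" "P \<noteq> 0"
  shows "graded b Q"
proof -
  have "monom P a * grading Q = monom P a * monom Q b"
    using assms by (simp add: graded_def ring_hom1D[OF ring_hom1_grading] mult_monom)
  then show ?thesis using assms(3) by (simp add: graded_def)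
qed

text \<open>The product \<open>P z^a * grading Q\<close> has no term in \<open>z^b\<close> for
  \<open>b < a\<close>, yet that coefficient is \<open>P * Q\<close>.\<close>

lemma graded_cancel_less:
  assumes "graded a P" "graded b (P * Q)" "P \<noteq> 0" "b < a"
  shows "Q = 0"
proof -
  have "monom P a * grading Q = monom (P * Q) b"
    using assms by (simp add: graded_def ring_hom1D[OF ring_hom1_grading])
  then have "coeff (monom P a * grading Q) b = P * Q" by simp
  then show ?thesis using assms(3,4) by (simp add: coeff_monom_mult)
qed

lemma map_poly_ring_hom1:
  assumes "ring_hom1 f"
  shows "ring_hom1 (map_poly f)"
proof -
  note f = ring_hom1D[OF assms]
  show ?thesis
    unfolding ring_hom1_def
  proof (intro conjI allI)
    show "map_poly f 1 = 1" by (rule map_poly_1') (rule f)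
    show "map_poly f (p + q) = map_poly f p + map_poly f q" for p q
      by (rule poly_eqI) (simp add: coeff_map_poly f)
    show "map_poly f (p * q) = map_poly f p * map_poly f q" for p q
      by (rule poly_eqI) (simp add: coeff_map_poly f coeff_mult ring_hom1_sum[OF assms])
  qed
qed

lemma map_poly_monom_hom: "ring_hom1 f \<Longrightarrow> map_poly f (monom c n) = monom (f c) n"
  by (rule poly_eqI) (simp add: coeff_map_poly ring_hom1D)

lemma graded_s:
  assumes "graded d P"
  shows "graded d (s i j P)"
proof -
  have "grading (s i j P) = map_poly (s i j) (grading P)"
  proof (rule ring_hom1_eqI)
    show "ring_hom1 (\<lambda>P. grading (s i j P))"
      by (rule ring_hom1_comp[OF ring_hom1_grading ring_hom1_s])
    show "ring_hom1 (\<lambda>P. map_poly (s i j) (grading P))"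
      by (rule ring_hom1_comp[OF map_poly_ring_hom1[OF ring_hom1_s] ring_hom1_grading])
    show "grading (s i j (const c)) = map_poly (s i j) (grading (const c))" for c
      by (simp add: s_const grading_const map_poly_monom_hom[OF ring_hom1_s])
    show "grading (s i j (var k)) = map_poly (s i j) (grading (var k))" for k
      by (simp add: s_var grading_var map_poly_monom_hom[OF ring_hom1_s])
  qed
  then show ?thesis
    using assms by (simp add: graded_def map_poly_monom_hom[OF ring_hom1_s])
qed

section \<open>The constant term, as evaluation at the origin\<close>

definition ev0 :: "poly3 \<Rightarrow> poly3" where
  "ev0 = ev const (\<lambda>_. 0)"

lemma ring_hom1_ev0: "ring_hom1 ev0"
  unfolding ev0_def by (rule ring_hom1_ev[OF ring_hom1_const])

lemma ev0_const: "ev0 (const c) = const c"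
  by (simp add: ev0_def ev_const ring_hom1_const)

lemma ev0_var: "ev0 (var i) = 0"
  by (simp add: ev0_def ev_var ring_hom1_const)

lemma ev0_range: "\<exists>c. ev0 P = const c"
proof (induction P rule: poly3_induct)
  case (1 u c)
  have "ev0 (Poly_Mapping.single u c) = const (c * 0 ^ Poly_Mapping.lookup u 1 * 0 ^ Poly_Mapping.lookup u 2 * 0 ^ Poly_Mapping.lookup u 3)"
    by (simp add: ev0_def ev_single[OF ring_hom1_const] prod_UNIV_3 const_mult ring_hom1D(7)[OF ring_hom1_const])
  then show ?case by blast
next
  case (2 P Q)
  then show ?case by (metis const_add ring_hom1D(2)[OF ring_hom1_ev0])
qed

text \<open>Setting \<open>z = 0\<close> in the grading evaluates at the origin. Hence degree 0
  means constant, and positive degree means no constant term.\<close>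

lemma coeff_grading_0: "coeff (grading P) 0 = ev0 P"
proof (rule ring_hom1_eqI[OF _ ring_hom1_ev0])
  show "ring_hom1 (\<lambda>P. coeff (grading P) 0)"
    by (rule ring_hom1_comp[of "\<lambda>p. coeff p 0", OF _ ring_hom1_grading]) (simp add: ring_hom1_def coeff_mult_0)
qed (simp_all add: grading_const grading_var ev0_const ev0_var)

lemma graded_0_const: "graded 0 P \<Longrightarrow> \<exists>c. P = const c"
  using coeff_grading_0[of P] ev0_range[of P] by (simp add: graded_def)

lemma graded_pos_ev0: "graded d P \<Longrightarrow> d > 0 \<Longrightarrow> ev0 P = 0"
  using coeff_grading_0[of P] by (simp add: graded_def)

section \<open>Divisibility by powers of the discriminant\<close>

lemma mult_diff_dvd:
  fixes d :: "'a::comm_ring_1"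
  assumes "d dvd a - b" "d dvd a' - b'"
  shows "d dvd a * a' - b * b'"
proof -
  have "a * a' - b * b' = (a - b) * a' + b * (a' - b')" by (simp add: algebra_simps)
  then show ?thesis using assms by simp
qed

lemma var_eq_iff: "var i = var j \<longleftrightarrow> i = j"
proof
  assume "var i = var j"
  then have "Poly_Mapping.keys (var i) = Poly_Mapping.keys (var j)" by simp
  then have "Poly_Mapping.single i (1::nat) = Poly_Mapping.single j 1" by (simp add: var_def)
  then have "Poly_Mapping.keys (Poly_Mapping.single i (1::nat)) = Poly_Mapping.keys (Poly_Mapping.single j (1::nat))" by simp
  then show "i = j" by simp
qed simp

text \<open>The substitution of \<open>x_j\<close> for \<open>x_i\<close>. Its kernel is the ideal
  generated by \<open>x_i - x_j\<close>, which makes this linear form prime.\<close>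

definition merge :: "3 \<Rightarrow> 3 \<Rightarrow> poly3 \<Rightarrow> poly3" where
  "merge i j = ev const (\<lambda>k. if k = i then var j else var k)"

lemma ring_hom1_merge: "ring_hom1 (merge i j)"
  unfolding merge_def by (rule ring_hom1_ev[OF ring_hom1_const])

lemma merge_var: "merge i j (var k) = (if k = i then var j else var k)"
  by (simp add: merge_def ev_var ring_hom1_const)

lemma diff_var_dvd_diff_merge: "var i - var j dvd P - merge i j P"
proof (induction P rule: poly3_induct)
  case (1 u c)
  have pow: "var i - var j dvd var k ^ n - merge i j (var k) ^ n" for k n
  proof (induction n)
    case (Suc n)
    then show ?case by (simp add: mult_diff_dvd merge_var)
  qed simp
  have "merge i j (const c) = const c" by (simp add: merge_def ev_const ring_hom1_const)
  then show ?case
    by (simp add: single_eq_const_mult_prod_var ring_hom1D[OF ring_hom1_merge] prod_UNIV_3 mult_diff_dvd pow)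
next
  case (2 P Q)
  then show ?case by (simp add: ring_hom1D[OF ring_hom1_merge] add_diff_add)
qed

lemma diff_var_dvd_iff: "var i - var j dvd P \<longleftrightarrow> merge i j P = 0"
proof
  assume "var i - var j dvd P"
  then obtain Q where "P = (var i - var j) * Q" ..
  then show "merge i j P = 0"
    by (simp add: ring_hom1D[OF ring_hom1_merge] merge_var)
next
  assume "merge i j P = 0"
  then show "var i - var j dvd P" using diff_var_dvd_diff_merge[of i j P] by simp
qed

text \<open>Since \<open>merge i j\<close> maps into an integral domain, \<open>x_i - x_j\<close>
  divides \<open>Q\<close> whenever it divides \<open>P * Q\<close> but not \<open>P\<close>. The
  induction removes one such factor at a time.\<close>

lemma diff_var_power_dvd_multD:
  assumes "(var i - var j) ^ n dvd P * Q" "\<not> var i - var j dvd P" "i \<noteq> j"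
  shows "(var i - var j) ^ n dvd Q"
  using assms(1)
proof (induction n arbitrary: Q)
  case (Suc n)
  have "var i - var j dvd P * Q"
    by (rule dvd_trans[OF _ Suc.prems]) simp
  then have "var i - var j dvd Q"
    using assms(2) by (simp add: diff_var_dvd_iff ring_hom1D[OF ring_hom1_merge])
  then obtain R where R: "Q = (var i - var j) * R" ..
  have "var i - var j \<noteq> 0" using assms(3) by (simp add: var_eq_iff)
  moreover have "(var i - var j) * (var i - var j) ^ n dvd (var i - var j) * (P * R)"
    using Suc.prems by (simp add: R ac_simps)
  ultimately have "(var i - var j) ^ n dvd P * R" by simp
  from Suc.IH[OF this] show ?case unfolding R power_Suc by (rule mult_dvd_mono[OF dvd_refl])
qed simp

section \<open>The action of the symmetric group\<close>

lemma exhaust_3: "i = 1 \<or> i = 2 \<or> i = 3" for i :: 3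
  using UNIV_I[of i] by (subst (asm) UNIV_3) simp

lemma s_12_var [simp]: "s 1 2 (var 1) = var 2" "s 1 2 (var 2) = var 1" "s 1 2 (var 3) = var 3"
  and s_23_var [simp]: "s 2 3 (var 1) = var 1" "s 2 3 (var 2) = var 3" "s 2 3 (var 3) = var 2"
  and s_13_var [simp]: "s 1 3 (var 1) = var 3" "s 1 3 (var 2) = var 2" "s 1 3 (var 3) = var 1"
  by (simp_all add: s_var transpose_def)

lemma ring_hom1_eqI_3:
  assumes "ring_hom1 f" "ring_hom1 g" "\<And>c. f (const c) = g (const c)"
    "f (var 1) = g (var 1)" "f (var 2) = g (var 2)" "f (var 3) = g (var 3)"
  shows "f P = g P"
proof (rule ring_hom1_eqI[OF assms(1-3)])
  show "f (var i) = g (var i)" for i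
    using exhaust_3[of i] assms(4-6) by (elim disjE) simp_all
qed

lemma ring_hom1_id: "ring_hom1 (\<lambda>P. P)"
  by (simp add: ring_hom1_def)

lemma s_involutive [simp]: "s i j (s i j P) = P"
  by (rule ring_hom1_eqI[OF ring_hom1_comp[OF ring_hom1_s ring_hom1_s] ring_hom1_id])
    (simp_all add: s_const s_var)

text \<open>With \<open>s_involutive\<close>, this orientation rewrites every word in
  \<open>s 1 2\<close> and \<open>s 2 3\<close> to one of six normal forms, one per group
  element.\<close>

lemma s_braid [simp]: "s 2 3 (s 1 2 (s 2 3 P)) = s 1 2 (s 2 3 (s 1 2 P))"
  by (rule ring_hom1_eqI_3[OF ring_hom1_comp[OF ring_hom1_s ring_hom1_comp[OF ring_hom1_s ring_hom1_s]]
        ring_hom1_comp[OF ring_hom1_s ring_hom1_comp[OF ring_hom1_s ring_hom1_s]]])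
    (simp_all add: s_const)

lemma s_13: "s 1 3 P = s 1 2 (s 2 3 (s 1 2 P))"
  by (rule ring_hom1_eqI_3[OF ring_hom1_s ring_hom1_comp[OF ring_hom1_s ring_hom1_comp[OF ring_hom1_s ring_hom1_s]]])
    (simp_all add: s_const)

lemma s_same: "s i i P = P"
  by (rule ring_hom1_eqI[OF ring_hom1_s ring_hom1_id]) (simp_all add: s_const s_var)

lemma s_commute: "s i j P = s j i P"
  by (rule ring_hom1_eqI[OF ring_hom1_s ring_hom1_s]) (simp_all add: s_const s_var transpose_commute)

lemma symmetric_iff: "symmetric P \<longleftrightarrow> s 1 2 P = P \<and> s 2 3 P = P"
proof
  assume *: "s 1 2 P = P \<and> s 2 3 P = P"
  then have "s 1 3 P = P" by (simp add: s_13)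
  then have "s i j P = P" for i j
    using * exhaust_3[of i] exhaust_3[of j]
    by (elim disjE) (simp_all add: s_same s_commute[of 2 1] s_commute[of 3 1] s_commute[of 3 2])
  then show "symmetric P" by (simp add: symmetric_def)
qed (simp add: symmetric_def)

lemma symmetric_const: "symmetric (const c)"
  and symmetric_add: "symmetric P \<Longrightarrow> symmetric Q \<Longrightarrow> symmetric (P + Q)"
  and symmetric_diff: "symmetric P \<Longrightarrow> symmetric Q \<Longrightarrow> symmetric (P - Q)"
  and symmetric_mult: "symmetric P \<Longrightarrow> symmetric Q \<Longrightarrow> symmetric (P * Q)"
  by (simp_all add: symmetric_def s_const s_add s_diff s_mult)

lemma symmetric_elementary: "symmetric e1" "symmetric e2" "symmetric e3"
  by (simp_all add: symmetric_iff e1_def e2_def e3_def s_add s_mult ac_simps)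

lemma s_dvd: "P dvd Q \<Longrightarrow> s i j P dvd s i j Q"
  by (auto simp: dvd_def s_mult)

lemma odd_power_diff_dvd_commute:
  "(a - b) ^ (2 * n + 1) dvd c \<longleftrightarrow> (b - a) ^ (2 * n + 1) dvd c" for a b c :: "'a::comm_ring_1"
proof -
  have "(a - b) ^ (2 * n + 1) = - ((b - a) ^ (2 * n + 1))"
    using power_minus_odd[of "2 * n + 1" "b - a"] by simp
  then show ?thesis by simp
qed

lemma QI_iff:
  "P \<in> QI m \<longleftrightarrow> (var 1 - var 2) ^ (2 * m + 1) dvd P - s 1 2 P \<and>
     (var 1 - var 3) ^ (2 * m + 1) dvd P - s 1 3 P \<and> (var 2 - var 3) ^ (2 * m + 1) dvd P - s 2 3 P"
  unfolding QI_def by simp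

lemma QI_add: "P \<in> QI m \<Longrightarrow> Q \<in> QI m \<Longrightarrow> P + Q \<in> QI m"
  and QI_mult: "P \<in> QI m \<Longrightarrow> Q \<in> QI m \<Longrightarrow> P * Q \<in> QI m"
  and QI_0: "0 \<in> QI m"
proof -
  interpret cring "QI_ring m" by (rule cring_QI_ring)
  show "P \<in> QI m \<Longrightarrow> Q \<in> QI m \<Longrightarrow> P + Q \<in> QI m" "P \<in> QI m \<Longrightarrow> Q \<in> QI m \<Longrightarrow> P * Q \<in> QI m" "0 \<in> QI m"
    using a_closed[of P Q] m_closed[of P Q] zero_closed by (simp_all add: QI_ring_def)
qed

lemma symmetric_QI: "symmetric P \<Longrightarrow> P \<in> QI m"
  by (simp add: QI_iff symmetric_def)

lemma QI_const: "const c \<in> QI m"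
  by (simp add: symmetric_QI symmetric_const)

lemma QI_diff: "P \<in> QI m \<Longrightarrow> Q \<in> QI m \<Longrightarrow> P - Q \<in> QI m"
  using QI_add[of P m "const (-1) * Q"] QI_mult[OF QI_const[of "-1"], of Q]
  by (simp add: const_uminus)

text \<open>Applying \<open>s 1 2\<close> to the three divisibilities permutes the linear forms up
  to sign and conjugates the transpositions accordingly. The odd exponent absorbs the sign.\<close>

lemma QI_s_12: assumes "P \<in> QI m" shows "s 1 2 P \<in> QI m"
proof -
  have "(var 2 - var 1) ^ (2 * m + 1) dvd s 1 2 P - P"
    "(var 2 - var 3) ^ (2 * m + 1) dvd s 1 2 P - s 1 2 (s 1 3 P)"
    "(var 1 - var 3) ^ (2 * m + 1) dvd s 1 2 P - s 1 2 (s 2 3 P)"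
    using assms[unfolded QI_iff, THEN conjunct1, THEN s_dvd, of 1 2]
      assms[unfolded QI_iff, THEN conjunct2, THEN conjunct1, THEN s_dvd, of 1 2]
      assms[unfolded QI_iff, THEN conjunct2, THEN conjunct2, THEN s_dvd, of 1 2]
    unfolding s_power s_diff s_12_var s_involutive .
  then show ?thesis
    unfolding QI_iff odd_power_diff_dvd_commute[of "var 1" "var 2"]
    by (simp add: s_13)
qed

lemma QI_s_23: assumes "P \<in> QI m" shows "s 2 3 P \<in> QI m"
proof -
  have "(var 3 - var 2) ^ (2 * m + 1) dvd s 2 3 P - P"
    "(var 1 - var 2) ^ (2 * m + 1) dvd s 2 3 P - s 2 3 (s 1 3 P)"
    "(var 1 - var 3) ^ (2 * m + 1) dvd s 2 3 P - s 2 3 (s 1 2 P)"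
    using assms[unfolded QI_iff, THEN conjunct2, THEN conjunct2, THEN s_dvd, of 2 3]
      assms[unfolded QI_iff, THEN conjunct2, THEN conjunct1, THEN s_dvd, of 2 3]
      assms[unfolded QI_iff, THEN conjunct1, THEN s_dvd, of 2 3]
    unfolding s_power s_diff s_23_var s_involutive .
  moreover have "s 2 3 (s 1 3 P) = s 1 2 (s 2 3 P)" "s 1 3 (s 2 3 P) = s 2 3 (s 1 2 P)"
    using s_braid[of "s 1 2 P"] s_braid[of "s 2 3 P"] by (simp_all add: s_13)
  ultimately show ?thesis
    unfolding QI_iff odd_power_diff_dvd_commute[of "var 2" "var 3"]
    by simp
qed

lemma \<Delta>_nonzero: "\<Delta> \<noteq> 0"
  by (simp add: \<Delta>_def var_eq_iff)

lemma s_\<Delta>: "s 1 2 \<Delta> = - \<Delta>" "s 2 3 \<Delta> = - \<Delta>"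
  by (simp_all add: \<Delta>_def s_mult s_diff s_add algebra_simps)

lemma graded_\<Delta>: "graded 3 \<Delta>"
proof -
  have "graded (1 + 1 + 1) \<Delta>"
    unfolding \<Delta>_def by (intro graded_mult graded_diff graded_var)
  then show ?thesis by (simp add: eval_nat_numeral)
qed

text \<open>The group carries the divisibility to the other two linear forms. The forms are pairwise
  non-associated primes, so the product of their powers divides \<open>P\<close>. For odd
  \<open>n\<close> the power of \<Delta> is itself alternating, so the quotient is
  symmetric.\<close>

lemma alternating_eq_\<Delta>_power_mult:
  assumes alt: "s 1 2 P = - P" "s 2 3 P = - P"
    and dvd: "(var 1 - var 2) ^ n dvd P" and "odd n"
  shows "\<exists>T. symmetric T \<and> P = \<Delta> ^ n * T"
proof -
  have dvd13: "(var 1 - var 3) ^ n dvd P"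
    using s_dvd[OF dvd, of 2 3] by (simp add: alt s_power s_diff)
  have dvd23: "(var 2 - var 3) ^ n dvd P"
    using s_dvd[OF dvd13, of 1 2] by (simp add: alt s_power s_diff)
  obtain Q where Q: "P = (var 1 - var 2) ^ n * Q" using dvd ..
  have "(var 1 - var 3) ^ n dvd Q"
    using dvd13 unfolding Q
    by (rule diff_var_power_dvd_multD)
      (simp_all add: diff_var_dvd_iff ring_hom1D[OF ring_hom1_merge] merge_var var_eq_iff)
  then obtain R where R: "Q = (var 1 - var 3) ^ n * R" ..
  have "(var 2 - var 3) ^ n dvd R"
    using dvd23 unfolding Q R mult.assoc[symmetric]
    by (rule diff_var_power_dvd_multD)
      (simp_all add: diff_var_dvd_iff ring_hom1D[OF ring_hom1_merge] merge_var var_eq_iff)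
  then obtain T where "R = (var 2 - var 3) ^ n * T" ..
  then have T: "P = \<Delta> ^ n * T"
    by (simp add: Q R \<Delta>_def power_mult_distrib)
  have "symmetric T"
    using alt \<open>odd n\<close> \<Delta>_nonzero by (simp add: symmetric_iff T s_mult s_power s_\<Delta>)
  then show ?thesis using T by blast
qed

section \<open>The standard isotypic component\<close>

text \<open>When \<open>s 2 3\<close> fixes \<open>P\<close>, the last summand is
  \<open>s 1 3 P\<close>. Applying \<open>s 2 3\<close> turns the stated divisibility into the one
  for \<open>x_1 - x_3\<close>, and the one for \<open>x_2 - x_3\<close> is trivial.\<close>

definition std :: "nat \<Rightarrow> poly3 \<Rightarrow> bool" where
  "std m P \<longleftrightarrow> s 2 3 P = P \<and> P + s 1 2 P + s 2 3 (s 1 2 P) = 0 \<and>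
     (var 1 - var 2) ^ (2 * m + 1) dvd P - s 1 2 P"

text \<open>The determinant with rows \<open>(P, Q)\<close> and \<open>(s 1 2 P, s 1 2 Q)\<close>;
  the transposition takes the place of a derivative.\<close>

definition wronski :: "poly3 \<Rightarrow> poly3 \<Rightarrow> poly3" where
  "wronski P Q = P * s 1 2 Q - Q * s 1 2 P"

lemma std_s:
  assumes "std m P"
  shows "s 2 3 P = P" "s 2 3 (s 1 2 P) = - P - s 1 2 P"
  using assms by (auto simp: std_def algebra_simps eq_neg_iff_add_eq_0)

lemma std_QI: "P \<in> QI m \<Longrightarrow> s 2 3 P = P \<Longrightarrow> P + s 1 2 P + s 2 3 (s 1 2 P) = 0 \<Longrightarrow> std m P"
  by (simp add: std_def QI_iff)

text \<open>On the determinant, \<open>s 1 2\<close> exchanges the rows, while \<open>s 2 3\<close>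
  keeps the first row and replaces the second by minus the sum of both, so each reverses the sign.
  Subtracting the second row from the first shows the divisibility.\<close>

lemma wronski_eq:
  assumes "std m P" "std m Q"
  shows "\<exists>T. symmetric T \<and> wronski P Q = \<Delta> ^ (2 * m + 1) * T"
proof (rule alternating_eq_\<Delta>_power_mult)
  show "s 1 2 (wronski P Q) = - wronski P Q"
    by (simp add: wronski_def s_diff s_mult)
  show "s 2 3 (wronski P Q) = - wronski P Q"
    by (simp add: wronski_def s_diff s_mult std_s[OF assms(1)] std_s[OF assms(2)] algebra_simps)
  have "wronski P Q = (P - s 1 2 P) * s 1 2 Q - (Q - s 1 2 Q) * s 1 2 P"
    by (simp add: wronski_def algebra_simps)
  then show "(var 1 - var 2) ^ (2 * m + 1) dvd wronski P Q"
    using assms by (simp add: std_def)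
qed simp

text \<open>Expansion of a vanishing 3 by 3 determinant in which the row \<open>(P, Q, R)\<close>
  occurs twice.\<close>

lemma wronski_cramer: "wronski P Q * R = wronski R Q * P + wronski P R * Q"
  by (simp add: wronski_def algebra_simps)

lemma graded_wronski: "graded a P \<Longrightarrow> graded b Q \<Longrightarrow> graded (a + b) (wronski P Q)"
  unfolding wronski_def by (metis add.commute graded_diff graded_mult graded_s)

section \<open>Quasiinvariants as integrals\<close>

definition primitive :: "poly3 poly \<Rightarrow> poly3 poly" where
  "primitive p = (\<Sum>k\<le>degree p. monom (const (1 / of_nat (Suc k)) * coeff p k) (Suc k))"

lemma coeff_primitive:
  "coeff (primitive p) 0 = 0" "coeff (primitive p) (Suc k) = const (1 / of_nat (Suc k)) * coeff p k"
  by (auto simp: primitive_def coeff_sum coeff_eq_0 when_def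
      simp flip: of_nat_Suc intro!: trans[OF sum.cong[OF refl if_cong[OF refl]]])

lemma const_of_nat: "const (of_nat n) = of_nat n"
  by (rule ring_hom1D[OF ring_hom1_const])

lemma pderiv_primitive: "pderiv (primitive p) = p"
proof (rule poly_eqI)
  fix k
  have "coeff (pderiv (primitive p)) k = const (of_nat (Suc k) * (1 / of_nat (Suc k))) * coeff p k"
    unfolding coeff_pderiv coeff_primitive const_mult const_of_nat by (simp only: mult.assoc)
  then show "coeff (pderiv (primitive p)) k = coeff p k"
    by (simp del: of_nat_Suc)
qed

lemma ring_hom1_poly:
  assumes "ring_hom1 f"
  shows "f (poly p x) = poly (map_poly f p) (f x)"
  by (induction p) (simp_all add: map_poly_pCons ring_hom1D[OF assms])

lemma ring_hom1_pcompose: "ring_hom1 (\<lambda>p. pcompose p q)"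
  by (simp add: ring_hom1_def pcompose_1 pcompose_add pcompose_mult)

text \<open>The difference is an integral from \<open>a\<close> to \<open>b\<close>. Substituting
  \<open>t = a + (b - a) u\<close> extracts \<open>(b - a)^m\<close> from each of the two powers and
  one more factor from \<open>dt\<close>. What remains is an integral over \<open>u\<close> from 0
  to 1, and its denominators are rational units.\<close>

lemma poly_diff_dvd:
  fixes G H :: "poly3 poly"
  assumes "pderiv G = [:-a, 1:] ^ m * [:-b, 1:] ^ m * H"
  shows "(b - a) ^ (2 * m + 1) dvd poly G b - poly G a"
proof -
  define K where "K = pcompose G [:a, b - a:]"
  define L where "L = [:0, 1:] ^ m * [:-1, 1:] ^ m * pcompose H [:a, b - a:]"
  have lin: "pcompose [:-a, 1:] [:a, b - a:] = smult (b - a) [:0, 1:]"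
    "pcompose [:-b, 1:] [:a, b - a:] = smult (b - a) [:-1, 1:]"
    by (simp_all add: pcompose_pCons)
  have "pderiv K = pcompose (pderiv G) [:a, b - a:] * [:b - a:]"
    by (simp add: K_def pderiv_pcompose pderiv_pCons)
  also have "pcompose (pderiv G) [:a, b - a:] =
      smult ((b - a) ^ m) ([:0, 1:] ^ m) * smult ((b - a) ^ m) ([:-1, 1:] ^ m) * pcompose H [:a, b - a:]"
    unfolding assms ring_hom1D(3,7)[OF ring_hom1_pcompose] lin smult_power ..
  also have "\<dots> * [:b - a:] = smult ((b - a) ^ (2 * m + 1)) L"
    by (simp add: L_def power_add[symmetric] ac_simps flip: mult_2_right)
  finally have K': "pderiv K = smult ((b - a) ^ (2 * m + 1)) L" .
  have "(b - a) ^ (2 * m + 1) dvd coeff K (Suc k)" for k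
  proof -
    have "const (of_nat (Suc k)) * coeff K (Suc k) = (b - a) ^ (2 * m + 1) * coeff L k"
      using arg_cong[OF K', of "\<lambda>p. coeff p k"] by (simp add: coeff_pderiv const_of_nat del: of_nat_Suc)
    then have "coeff K (Suc k) = const (1 / of_nat (Suc k)) * ((b - a) ^ (2 * m + 1) * coeff L k)"
      by (metis const_inverse_mult of_nat_eq_0_iff nat.distinct(2))
    then show ?thesis by simp
  qed
  \<comment> \<open>Only the constant coefficient of \<open>K\<close> may fail to be divisible, and
    it drops out of \<open>K(1) - K(0)\<close>.\<close>
  moreover obtain c K1 where K1: "K = pCons c K1" by (rule pCons_cases)
  ultimately have "(b - a) ^ (2 * m + 1) dvd poly K1 1"
    by (auto simp: poly_altdef intro!: dvd_sum)
  moreover have "poly K1 1 = poly K 1 - poly K 0" by (simp add: K1)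
  moreover have "poly K 1 = poly G b" "poly K 0 = poly G a" by (simp_all add: K_def poly_pcompose)
  ultimately show ?thesis by simp
qed

definition cubic :: "poly3 poly" where
  "cubic = [:- e3, e2, - e1, 1:]"

lemma cubic_eq: "cubic = [:- var 1, 1:] * [:- var 2, 1:] * [:- var 3, 1:]"
  by (simp add: cubic_def e1_def e2_def e3_def algebra_simps)

lemma map_poly_s_cubic: "map_poly (s i j) cubic = cubic"
  using symmetric_elementary
  by (simp add: cubic_def map_poly_pCons s_0 s_1 s_uminus symmetric_def)

definition weight_primitive :: "nat \<Rightarrow> nat \<Rightarrow> poly3 poly" where
  "weight_primitive m r = primitive (cubic ^ m * monom 1 r)"

lemma s_poly_weight_primitive: "s i j (poly (weight_primitive m r) x) = poly (weight_primitive m r) (s i j x)"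
proof -
  have "map_poly (s i j) (cubic ^ m * monom 1 r) = cubic ^ m * monom 1 r"
    by (simp add: ring_hom1D[OF map_poly_ring_hom1[OF ring_hom1_s]] map_poly_s_cubic
        map_poly_monom_hom[OF ring_hom1_s] s_1)
  then have "s i j (coeff (cubic ^ m * monom 1 r) k) = coeff (cubic ^ m * monom 1 r) k" for k
    by (metis coeff_map_poly s_0)
  then have "map_poly (s i j) (weight_primitive m r) = weight_primitive m r"
    unfolding weight_primitive_def
    by (intro poly_eqI, case_tac n) (simp_all add: coeff_map_poly s_0 coeff_primitive s_mult s_const)
  then show ?thesis by (simp add: ring_hom1_poly[OF ring_hom1_s])
qed

text \<open>The integral of \<open>t^r * cubic^m\<close> from \<open>x_1\<close> to
  \<open>x_2\<close> plus the one from \<open>x_1\<close> to \<open>x_3\<close>: fixed by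
  \<open>s 2 3\<close>, with orbit sum zero.\<close>

definition std_gen :: "nat \<Rightarrow> nat \<Rightarrow> poly3" where
  "std_gen m r = poly (weight_primitive m r) (var 2) + poly (weight_primitive m r) (var 3)
     - 2 * poly (weight_primitive m r) (var 1)"

lemma std_std_gen: "std m (std_gen m r)"
proof -
  let ?y = "\<lambda>i. poly (weight_primitive m r) (var i)"
  \<comment> \<open>The integrand vanishes to order at least \<open>m\<close> at both
    \<open>x_1\<close> and \<open>x_2\<close>; the factors of the third root and of
    \<open>t^r\<close> play the part of \<open>H\<close>.\<close>
  have "pderiv (weight_primitive m r) = [:- var 2, 1:] ^ m * [:- var 1, 1:] ^ m * ([:- var 3, 1:] ^ m * monom 1 r)"
    unfolding weight_primitive_def pderiv_primitive cubic_eq power_mult_distrib by (simp only: ac_simps)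
  from poly_diff_dvd[OF this] have "(var 1 - var 2) ^ (2 * m + 1) dvd - 3 * (?y 1 - ?y 2)"
    by (rule dvd_mult)
  moreover have "std_gen m r - s 1 2 (std_gen m r) = - 3 * (?y 1 - ?y 2)"
    by (simp add: std_gen_def s_diff s_add s_mult s_numeral s_poly_weight_primitive algebra_simps)
  ultimately show ?thesis
    by (simp add: std_def) (simp add: std_gen_def s_diff s_add s_mult s_numeral s_poly_weight_primitive)
qed

text \<open>Homogeneity of total degree \<open>d\<close> when \<open>t\<close> has degree 1.
  Multiplying by \<open>z^k\<close> on the left avoids the truncated difference
  \<open>d - k\<close>.\<close>

definition graded_poly :: "nat \<Rightarrow> poly3 poly \<Rightarrow> bool" where
  "graded_poly d p \<longleftrightarrow> (\<forall>k. grading (coeff p k) * monom 1 k = monom (coeff p k) d)"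

lemma graded_poly_mult:
  assumes "graded_poly a p" "graded_poly b q"
  shows "graded_poly (a + b) (p * q)"
  unfolding graded_poly_def
proof
  fix n
  have "grading (coeff (p * q) n) * monom 1 n =
      (\<Sum>i\<le>n. (grading (coeff p i) * monom 1 i) * (grading (coeff q (n - i)) * monom 1 (n - i)))"
    unfolding coeff_mult ring_hom1_sum[OF ring_hom1_grading] sum_distrib_right
  proof (rule sum.cong)
    fix i assume "i \<in> {..n}"
    then have "monom 1 n = monom 1 i * (monom 1 (n - i) :: poly3 poly)" by (simp add: mult_monom)
    then show "grading (coeff p i * coeff q (n - i)) * monom 1 n =
        (grading (coeff p i) * monom 1 i) * (grading (coeff q (n - i)) * monom 1 (n - i))"
      by (simp only: ring_hom1D[OF ring_hom1_grading] ac_simps)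
  qed simp
  also have "\<dots> = monom (coeff (p * q) n) (a + b)"
    using assms by (simp add: graded_poly_def mult_monom coeff_mult monom_sum)
  finally show "grading (coeff (p * q) n) * monom 1 n = monom (coeff (p * q) n) (a + b)" .
qed

lemma graded_poly_power: "graded_poly d p \<Longrightarrow> graded_poly (d * n) (p ^ n)"
proof (induction n)
  case 0
  have "graded_poly 0 1"
    unfolding graded_poly_def
  proof
    fix k
    show "grading (coeff 1 k) * monom 1 k = monom (coeff 1 k) 0"
      by (cases k) (simp_all add: ring_hom1D[OF ring_hom1_grading])
  qed
  then show ?case by simp
next
  case (Suc n)
  then show ?case using graded_poly_mult by fastforce
qed

lemma graded_poly_monom: "graded_poly n (monom 1 n)"
  by (simp add: graded_poly_def ring_hom1D[OF ring_hom1_grading])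

lemma graded_poly_cubic: "graded_poly 3 cubic"
proof -
  have "graded (1 + 1 + 1) e3" "graded (1 + 1) e2" "graded 1 e1"
    unfolding e3_def e2_def e1_def by (intro graded_mult graded_add graded_var)+
  then have *: "grading e3 = monom e3 3" "grading e2 = monom e2 2" "grading e1 = monom e1 1"
    by (simp_all add: graded_def eval_nat_numeral)
  show ?thesis
    unfolding graded_poly_def
  proof
    fix k
    consider "k = 0" | "k = 1" | "k = 2" | "k = 3" | l where "k = Suc (Suc (Suc (Suc l)))"
      by (metis One_nat_def Suc_1 numeral_3_eq_3 old.nat.exhaust)
    then show "grading (coeff cubic k) * monom 1 k = monom (coeff cubic k) 3"
      by cases (simp_all add: cubic_def ring_hom1D[OF ring_hom1_grading] * mult_monom minus_monom
          eval_nat_numeral)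
  qed
qed

lemma graded_poly_primitive:
  assumes "graded_poly d p"
  shows "graded_poly (d + 1) (primitive p)"
  unfolding graded_poly_def
proof
  fix k
  show "grading (coeff (primitive p) k) * monom 1 k = monom (coeff (primitive p) k) (d + 1)"
  proof (cases k)
    case (Suc l)
    have "grading (coeff (primitive p) k) * monom 1 k =
        grading (const (1 / of_nat (Suc l))) * (grading (coeff p l) * monom 1 l) * monom 1 1"
      by (simp add: Suc coeff_primitive ring_hom1D[OF ring_hom1_grading] mult.assoc mult_monom)
    also have "\<dots> = monom (coeff (primitive p) k) (d + 1)"
      using assms by (simp add: graded_poly_def grading_const mult_monom Suc coeff_primitive)
    finally show ?thesis .
  qed (simp add: coeff_primitive ring_hom1D[OF ring_hom1_grading])
qed

lemma graded_poly_eval: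
  assumes "graded_poly d p"
  shows "graded d (poly p (var i))"
proof -
  have *: "grading (coeff p k * var i ^ k) = monom (coeff p k * var i ^ k) d" for k
  proof -
    have "monom (var i) 1 ^ k = monom 1 k * monom (var i ^ k) 0"
      by (simp add: monom_power mult_monom)
    then have "grading (coeff p k * var i ^ k) = (grading (coeff p k) * monom 1 k) * monom (var i ^ k) 0"
      by (simp only: ring_hom1D[OF ring_hom1_grading] grading_var mult.assoc)
    then show ?thesis using assms by (simp add: graded_poly_def mult_monom)
  qed
  show ?thesis
    by (simp add: graded_def poly_altdef ring_hom1_sum[OF ring_hom1_grading] * monom_sum)
qed

lemma graded_std_gen: "graded (3 * m + r + 1) (std_gen m r)"
proof -
  have "graded_poly (3 * m + r + 1) (weight_primitive m r)"
    unfolding weight_primitive_def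
    by (intro graded_poly_primitive graded_poly_mult graded_poly_power graded_poly_cubic graded_poly_monom)
  then have "graded (3 * m + r + 1) (poly (weight_primitive m r) (var i))" for i
    by (rule graded_poly_eval)
  then show ?thesis
    unfolding std_gen_def const_numeral[symmetric] by (intro graded_diff graded_add graded_const_mult)
qed

text \<open>At the point \<open>(-1, 0, 1)\<close> the integrands \<open>(t\<^sup>3 - t)\<^sup>m\<close> and \<open>t (t\<^sup>3 - t)\<^sup>m\<close> have opposite signs on
  \<open>(-1, 0)\<close> and equal signs on \<open>(0, 1)\<close>.\<close>

lemma wronski_std_gen_nonzero: "wronski (std_gen m 0) (std_gen m 1) \<noteq> 0"
proof
  define f :: "poly3 \<Rightarrow> real" where "f = ev of_rat (\<lambda>i. if i = 1 then -1 else if i = 2 then 0 else 1)"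
  have rat: "ring_hom1 (of_rat :: rat \<Rightarrow> real)"
    by (simp add: ring_hom1_def of_rat_add of_rat_mult)
  have f: "ring_hom1 f" unfolding f_def by (rule ring_hom1_ev[OF rat])
  have fv: "f (var 1) = -1" "f (var 2) = 0" "f (var 3) = 1"
    by (simp_all add: f_def ev_var[OF rat])
  define g where "g r = map_poly f (weight_primitive m r)" for r
  have fg: "f (poly (weight_primitive m r) x) = poly (g r) (f x)" for r x
    by (simp add: g_def ring_hom1_poly[OF f])
  have "map_poly f (pderiv p) = pderiv (map_poly f p)" for p
    by (rule poly_eqI) (simp add: coeff_map_poly coeff_pderiv ring_hom1D[OF f] del: of_nat_Suc)
  then have "pderiv (g r) = map_poly f (cubic ^ m * monom 1 r)" for r
    by (metis g_def weight_primitive_def pderiv_primitive)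
  moreover have "map_poly f cubic = [:0, -1, 0, 1:]"
    by (simp add: cubic_def map_poly_pCons ring_hom1D[OF f] e1_def e2_def e3_def fv)
  ultimately have g': "poly (pderiv (g r)) t = (t ^ 3 - t) ^ m * t ^ r" for r t
    by (simp add: ring_hom1D[OF map_poly_ring_hom1[OF f]] map_poly_monom_hom[OF f] ring_hom1D[OF f]
        poly_monom algebra_simps eval_nat_numeral)
  \<comment> \<open>The mean value theorem supplies the signs of the integrals. Both intervals have
    length 1, so no length factor appears.\<close>
  have mvt: "\<exists>t>u. t < u + 1 \<and> poly (g r) (u + 1) - poly (g r) u = (t ^ 3 - t) ^ m * t ^ r" for r u
    using poly_MVT[of u "u + 1" "g r"] by (simp add: g')
  define y where "y r i = f (poly (weight_primitive m r) (var i))" for r i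
  have y: "y r 1 = poly (g r) (- 1)" "y r 2 = poly (g r) 0" "y r 3 = poly (g r) 1" for r
    by (simp_all add: y_def fg fv)
  have pos: "t ^ 3 - t > 0" if "-1 < t" "t < 0" for t :: real
  proof -
    have "t ^ 3 - t = (- t) * ((1 - t) * (1 + t))" by (simp add: algebra_simps eval_nat_numeral)
    moreover have "\<dots> > 0" using that by (intro mult_pos_pos) auto
    ultimately show ?thesis by (simp only:)
  qed
  have pos': "t - t ^ 3 > 0" if "0 < t" "t < 1" for t :: real
  proof -
    have "t - t ^ 3 = t * ((1 - t) * (1 + t))" by (simp add: algebra_simps eval_nat_numeral)
    then show ?thesis using that by simp
  qed
  have left: "y 0 2 - y 0 1 > 0" "y 1 2 - y 1 1 < 0"
  proof -
    obtain t where "-1 < t" "t < 0" "y 0 2 - y 0 1 = (t ^ 3 - t) ^ m"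
      using mvt[of "-1" 0] by (auto simp: y)
    then show "y 0 2 - y 0 1 > 0" using zero_less_power[OF pos[of t], of m] by simp
    obtain t where "-1 < t" "t < 0" "y 1 2 - y 1 1 = (t ^ 3 - t) ^ m * t"
      using mvt[of "-1" 1] by (auto simp: y)
    then show "y 1 2 - y 1 1 < 0" using mult_pos_neg[OF zero_less_power[OF pos[of t], of m], of t] by simp
  qed
  \<comment> \<open>On \<open>(0, 1)\<close> the base \<open>t^3 - t\<close> is negative, so the
    common sign \<open>(-1)^m\<close> is factored out there.\<close>
  have sgn: "(-1) ^ m * (t ^ 3 - t) ^ m = (t - t ^ 3) ^ m" for t :: real
    by (simp add: power_mult_distrib[symmetric])
  have right: "(-1) ^ m * (y 0 3 - y 0 2) > 0" "(-1) ^ m * (y 1 3 - y 1 2) > 0"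
  proof -
    obtain t where "0 < t" "t < 1" "y 0 3 - y 0 2 = (t ^ 3 - t) ^ m"
      using mvt[of 0 0] by (auto simp: y)
    then show "(-1) ^ m * (y 0 3 - y 0 2) > 0" using zero_less_power[OF pos'[of t], of m] by (simp add: sgn)
    obtain t where "0 < t" "t < 1" "y 1 3 - y 1 2 = (t ^ 3 - t) ^ m * t"
      using mvt[of 0 1] by (auto simp: y)
    then show "(-1) ^ m * (y 1 3 - y 1 2) > 0"
      using mult_pos_pos[OF zero_less_power[OF pos'[of t], of m], of t]
      by (simp add: sgn mult.assoc[symmetric])
  qed
  assume "wronski (std_gen m 0) (std_gen m 1) = 0"
  then have "f (wronski (std_gen m 0) (std_gen m 1)) = 0" by (simp add: ring_hom1D[OF f])
  moreover have "f 2 = 2" using ring_hom1D(8)[OF f, of 2] by simp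
  ultimately have "(y 0 2 + y 0 3 - 2 * y 0 1) * (y 1 1 + y 1 3 - 2 * y 1 2)
      - (y 1 2 + y 1 3 - 2 * y 1 1) * (y 0 1 + y 0 3 - 2 * y 0 2) = 0"
    by (simp add: wronski_def std_gen_def s_diff s_add s_mult s_numeral s_poly_weight_primitive
        ring_hom1D[OF f] y_def)
  \<comment> \<open>In terms of integrals over the two intervals, the determinant is 3 times a 2 by
    2 determinant. After scaling by \<open>(-1)^m\<close> its two products have opposite
    signs.\<close>
  then have "3 * ((y 0 2 - y 0 1) * (y 1 3 - y 1 2)) = 3 * ((y 1 2 - y 1 1) * (y 0 3 - y 0 2))"
    by (simp add: algebra_simps)
  then have "(y 0 2 - y 0 1) * (y 1 3 - y 1 2) = (y 1 2 - y 1 1) * (y 0 3 - y 0 2)"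
    by simp
  then have "(y 0 2 - y 0 1) * ((-1) ^ m * (y 1 3 - y 1 2)) = (y 1 2 - y 1 1) * ((-1) ^ m * (y 0 3 - y 0 2))"
    by (simp only: mult.left_commute[of "y 0 2 - y 0 1"] mult.left_commute[of "y 1 2 - y 1 1"])
  then show False
    using mult_pos_pos[OF left(1) right(2)] mult_neg_pos[OF left(2) right(1)] by linarith
qed

section \<open>The ideal generated by the elementary symmetric polynomials\<close>

text \<open>The six monomials are the Artin monomials spanning the coinvariant algebra. Here the
  multipliers of the \<open>e_i\<close> are arbitrary polynomials.\<close>

definition coinvariant_repr :: "poly3 \<Rightarrow> bool" where
  "coinvariant_repr P \<longleftrightarrow> (\<exists>r1 r2 r3 c0 c1 c2 c3 c4 c5. P = e1 * r1 + e2 * r2 + e3 * r3 +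
     (const c0 + const c1 * var 1 + const c2 * (var 1 * var 1) + const c3 * var 2 +
      const c4 * (var 1 * var 2) + const c5 * (var 1 * (var 1 * var 2))))"

lemma coinvariant_reprI:
  "P = e1 * r1 + e2 * r2 + e3 * r3 +
     (const c0 + const c1 * var 1 + const c2 * (var 1 * var 1) + const c3 * var 2 +
      const c4 * (var 1 * var 2) + const c5 * (var 1 * (var 1 * var 2))) \<Longrightarrow> coinvariant_repr P"
  unfolding coinvariant_repr_def by blast

lemma coinvariant_repr_add:
  assumes "coinvariant_repr P" "coinvariant_repr Q"
  shows "coinvariant_repr (P + Q)"
proof -
  obtain r1 r2 r3 c0 c1 c2 c3 c4 c5 q1 q2 q3 d0 d1 d2 d3 d4 d5 where
    P: "P = e1 * r1 + e2 * r2 + e3 * r3 +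
     (const c0 + const c1 * var 1 + const c2 * (var 1 * var 1) + const c3 * var 2 +
      const c4 * (var 1 * var 2) + const c5 * (var 1 * (var 1 * var 2)))" and
    Q: "Q = e1 * q1 + e2 * q2 + e3 * q3 +
     (const d0 + const d1 * var 1 + const d2 * (var 1 * var 1) + const d3 * var 2 +
      const d4 * (var 1 * var 2) + const d5 * (var 1 * (var 1 * var 2)))"
    using assms unfolding coinvariant_repr_def by blast
  show ?thesis
    by (rule coinvariant_reprI[of _ "r1 + q1" "r2 + q2" "r3 + q3" "c0 + d0" "c1 + d1" "c2 + d2" "c3 + d3" "c4 + d4" "c5 + d5"])
      (simp add: P Q const_add algebra_simps)
qed

lemma coinvariant_repr_const_mult:
  assumes "coinvariant_repr P"
  shows "coinvariant_repr (const c * P)"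
proof -
  obtain r1 r2 r3 c0 c1 c2 c3 c4 c5 where
    P: "P = e1 * r1 + e2 * r2 + e3 * r3 +
     (const c0 + const c1 * var 1 + const c2 * (var 1 * var 1) + const c3 * var 2 +
      const c4 * (var 1 * var 2) + const c5 * (var 1 * (var 1 * var 2)))"
    using assms unfolding coinvariant_repr_def by blast
  show ?thesis
    by (rule coinvariant_reprI[of _ "const c * r1" "const c * r2" "const c * r3" "c * c0" "c * c1" "c * c2" "c * c3" "c * c4" "c * c5"])
      (simp add: P const_mult algebra_simps)
qed

lemma coinvariant_repr_e1_mult: "coinvariant_repr (e1 * P)"
  by (rule coinvariant_reprI[of _ P 0 0 0 0 0 0 0 0]) simp

text \<open>The rewriting rules modulo \<open>e\<^sub>1, e\<^sub>2, e\<^sub>3\<close> are \<open>x\<^sub>1\<^sup>3 = 0\<close>, \<open>x\<^sub>2\<^sup>2 = - x\<^sub>1\<^sup>2 - x\<^sub>1 x\<^sub>2\<close> and \<open>x\<^sub>3 = - x\<^sub>1 - x\<^sub>2\<close>.\<close>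

lemma coinvariant_repr_var_mult:
  assumes "coinvariant_repr P"
  shows "coinvariant_repr (var i * P)"
proof -
  obtain r1 r2 r3 c0 c1 c2 c3 c4 c5 where
    P: "P = e1 * r1 + e2 * r2 + e3 * r3 +
     (const c0 + const c1 * var 1 + const c2 * (var 1 * var 1) + const c3 * var 2 +
      const c4 * (var 1 * var 2) + const c5 * (var 1 * (var 1 * var 2)))"
    using assms unfolding coinvariant_repr_def by blast
  let ?x = "var 1" and ?y = "var 2"
  \<comment> \<open>The witnesses lift \<open>x_1^3 = 0\<close> to
    \<open>x_1^3 = e1 x_1^2 - e2 x_1 + e3\<close>.\<close>
  have 1: "coinvariant_repr (?x * P)"
    by (rule coinvariant_reprI[of _ "?x * r1 + const c2 * (?x * ?x) + const c5 * (?x * ?x * ?y)"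
          "?x * r2 - const c2 * ?x - const c5 * (?x * ?y)" "?x * r3 + const c2 + const c5 * ?y"
          0 c0 c1 0 c3 c4])
      (simp add: P e1_def e2_def e3_def algebra_simps)
  \<comment> \<open>For \<open>x = x_1\<close> and \<open>y = x_2\<close> the witnesses come from
    \<open>y^2 = (x + y) e1 - e2 - x^2 - x y\<close>, \<open>x y^2 = x y e1 - e3 - x^2 y\<close> and
    \<open>x^2 y^2 = x y e2 - (x + y) e3\<close>.\<close>
  have 2: "coinvariant_repr (?y * P)"
    by (rule coinvariant_reprI[of _ "?y * r1 + const c3 * (?x + ?y) + const c4 * (?x * ?y)"
          "?y * r2 - const c3 + const c5 * (?x * ?y)" "?y * r3 - const c4 - const c5 * (?x + ?y)"
          0 0 "- c3" c0 "c1 - c3" "c2 - c4"])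
      (simp add: P e1_def e2_def e3_def const_diff const_uminus algebra_simps)
  have "var 3 * P = e1 * P + (const (-1) * (?x * P) + const (-1) * (?y * P))"
    by (simp add: e1_def const_uminus algebra_simps)
  also have "coinvariant_repr \<dots>"
    by (intro coinvariant_repr_add coinvariant_repr_const_mult coinvariant_repr_e1_mult 1 2)
  finally show ?thesis using 1 2 exhaust_3[of i] by auto
qed

lemma coinvariant_repr_all: "coinvariant_repr P"
proof (induction P rule: poly3_induct)
  case (1 u c)
  have pow: "coinvariant_repr (var i ^ n * P)" if "coinvariant_repr P" for i n P
    using that by (induction n) (simp_all add: coinvariant_repr_var_mult mult.assoc)
  have "coinvariant_repr 1"
    by (rule coinvariant_reprI[of _ 0 0 0 1 0 0 0 0 0]) simp
  then have "coinvariant_repr (const c * (var 1 ^ Poly_Mapping.lookup u 1 *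
      (var 2 ^ Poly_Mapping.lookup u 2 * (var 3 ^ Poly_Mapping.lookup u 3 * 1))))"
    by (intro coinvariant_repr_const_mult pow)
  then show ?case
    by (simp add: single_eq_const_mult_prod_var[of u c] prod_UNIV_3 mult.assoc)
qed (rule coinvariant_repr_add)

section \<open>Averaging over the symmetric group\<close>

definition reynolds :: "poly3 \<Rightarrow> poly3" where
  "reynolds P = const (1 / 6) * (P + s 1 2 P + s 2 3 P + s 1 2 (s 2 3 P) + s 2 3 (s 1 2 P)
     + s 1 2 (s 2 3 (s 1 2 P)))"

lemma symmetric_reynolds: "symmetric (reynolds P)"
  by (simp add: symmetric_iff reynolds_def s_mult s_const s_add ac_simps)

lemma reynolds_add: "reynolds (P + Q) = reynolds P + reynolds Q"
  by (simp add: reynolds_def s_add algebra_simps)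

lemma reynolds_mult: "symmetric P \<Longrightarrow> reynolds (P * Q) = P * reynolds Q"
  by (simp add: reynolds_def symmetric_def s_mult algebra_simps)

lemma const_sixth: "const (1 / 6) * (6 * P) = P"
  using const_inverse_mult[of 6 P] by (simp add: const_numeral)

lemma reynolds_symmetric: "symmetric P \<Longrightarrow> reynolds P = P"
  using const_sixth[of P] by (simp add: reynolds_def symmetric_def)

text \<open>The three terms of the ideal can be averaged, since \<open>e\<^sub>1, e\<^sub>2, e\<^sub>3\<close> are symmetric.\<close>

lemma symmetric_in_elementary_ideal:
  assumes "symmetric P" "ev0 P = 0"
  shows "\<exists>a b c. symmetric a \<and> symmetric b \<and> symmetric c \<and> P = e1 * a + e2 * b + e3 * c"
proof -
  obtain r1 r2 r3 c0 c1 c2 c3 c4 c5 where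
    P: "P = e1 * r1 + e2 * r2 + e3 * r3 +
     (const c0 + const c1 * var 1 + const c2 * (var 1 * var 1) + const c3 * var 2 +
      const c4 * (var 1 * var 2) + const c5 * (var 1 * (var 1 * var 2)))"
    using coinvariant_repr_all[of P] unfolding coinvariant_repr_def by blast
  have "ev0 P = const c0"
    by (simp add: P e1_def e2_def e3_def ring_hom1D[OF ring_hom1_ev0] ev0_var ev0_const)
  then have c0: "c0 = 0" using assms(2) by simp
  let ?k = "const (1 / 6)"
  \<comment> \<open>Averages of the nonconstant Artin monomials, by Newton's identities: the power
    sum of degree 2 is \<open>e1^2 - 2 e2\<close>, and the orbit sum of \<open>x_1^2 x_2\<close> is
    \<open>e1 e2 - 3 e3\<close>.\<close>
  have mon: "reynolds (var 1) = ?k * (2 * e1)" "reynolds (var 2) = ?k * (2 * e1)"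
    "reynolds (var 1 * var 1) = ?k * (2 * (e1 * e1) - 4 * e2)"
    "reynolds (var 1 * var 2) = ?k * (2 * e2)"
    "reynolds (var 1 * (var 1 * var 2)) = ?k * (e1 * e2 - 3 * e3)"
    by (simp_all add: reynolds_def s_mult e1_def e2_def e3_def algebra_simps)
  have "P = reynolds P" using assms(1) by (simp add: reynolds_symmetric)
  also have "\<dots> = e1 * (reynolds r1 + const c1 * (?k * 2) + const c2 * (?k * (2 * e1)) + const c3 * (?k * 2)
        + const c5 * (?k * e2)) + e2 * (reynolds r2 - const c2 * (?k * 4) + const c4 * (?k * 2))
        + e3 * (reynolds r3 - const c5 * (?k * 3))"
    unfolding P c0
    by (simp add: reynolds_add reynolds_mult symmetric_elementary symmetric_const mon algebra_simps)
  finally show ?thesis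
    unfolding const_numeral[symmetric]
    by (intro exI conjI; assumption?)
      (intro symmetric_add symmetric_diff symmetric_mult symmetric_const symmetric_elementary symmetric_reynolds)+
qed

section \<open>The ideal inside the ring of quasiinvariants\<close>

lemma QI_ring_simps [simp]:
  "carrier (QI_ring m) = QI m" "P \<otimes>\<^bsub>QI_ring m\<^esub> Q = P * Q" "\<one>\<^bsub>QI_ring m\<^esub> = 1"
  "\<zero>\<^bsub>QI_ring m\<^esub> = 0" "P \<oplus>\<^bsub>QI_ring m\<^esub> Q = P + Q"
  by (simp_all add: QI_ring_def)

lemma QI_ring_minus: "P \<in> QI m \<Longrightarrow> Q \<in> QI m \<Longrightarrow> P \<ominus>\<^bsub>QI_ring m\<^esub> Q = P - Q"
proof -
  assume PQ: "P \<in> QI m" "Q \<in> QI m"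
  interpret cring "QI_ring m" by (rule cring_QI_ring)
  have "\<ominus>\<^bsub>QI_ring m\<^esub> Q = - Q"
    using PQ QI_diff[OF QI_0 PQ(2)] by (intro minus_equality) simp_all
  then show ?thesis by (simp add: a_minus_def)
qed

lemma ideal_e_ideal: "ideal (e_ideal m) (QI_ring m)"
  unfolding e_ideal_def
  by (rule ring.genideal_ideal) (use cring_QI_ring elementary_in_QI in \<open>auto simp: cring_def\<close>)

text \<open>The coefficients are restricted to quasiinvariants, so membership is stronger than
  membership in the ideal of the full polynomial ring.\<close>

lemma e_ideal_eq: "e_ideal m = {e1 * a + e2 * b + e3 * c | a b c. a \<in> QI m \<and> b \<in> QI m \<and> c \<in> QI m}"
    (is "_ = ?J")
proof
  interpret cring "QI_ring m" by (rule cring_QI_ring)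
  interpret I: ideal "e_ideal m" "QI_ring m" by (rule ideal_e_ideal)
  have e: "e1 \<in> QI m" "e2 \<in> QI m" "e3 \<in> QI m" using elementary_in_QI by auto
  have "{e1, e2, e3} \<subseteq> e_ideal m"
    unfolding e_ideal_def by (rule genideal_self) (use e in auto)
  then show "?J \<subseteq> e_ideal m"
    using I.I_r_closed I.a_closed by auto
  have J: "e1 * a + e2 * b + e3 * c \<in> ?J" if "a \<in> QI m" "b \<in> QI m" "c \<in> QI m" for a b c
    using that by blast
  have "ideal ?J (QI_ring m)"
  proof (rule idealI)
    show "ring (QI_ring m)" by (rule ring_axioms)
    show "subgroup ?J (add_monoid (QI_ring m))"
    proof (rule add.subgroupI)
      show "?J \<subseteq> carrier (QI_ring m)" using e by (auto intro!: QI_add QI_mult)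
      show "?J \<noteq> {}" using QI_0 by blast
      show "\<ominus>\<^bsub>QI_ring m\<^esub> x \<in> ?J" if xJ: "x \<in> ?J" for x
      proof -
        obtain a b c where abc: "a \<in> QI m" "b \<in> QI m" "c \<in> QI m" and x: "x = e1 * a + e2 * b + e3 * c"
          using xJ by blast
        have "x \<in> QI m" using abc e by (auto simp: x intro!: QI_add QI_mult)
        then have "\<ominus>\<^bsub>QI_ring m\<^esub> x = - x"
          using QI_ring_minus[OF QI_0, of x m] by (simp add: a_minus_def)
        also have "\<dots> = e1 * (0 - a) + e2 * (0 - b) + e3 * (0 - c)"
          by (simp add: x algebra_simps)
        also have "\<dots> \<in> ?J" using abc by (intro J QI_diff QI_0)
        finally show ?thesis .
      qed
      show "x \<oplus>\<^bsub>QI_ring m\<^esub> y \<in> ?J" if "x \<in> ?J" "y \<in> ?J" for x y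
      proof -
        obtain a b c a' b' c' where abc: "a \<in> QI m" "b \<in> QI m" "c \<in> QI m" "a' \<in> QI m" "b' \<in> QI m" "c' \<in> QI m"
          and xy: "x = e1 * a + e2 * b + e3 * c" "y = e1 * a' + e2 * b' + e3 * c'"
          using \<open>x \<in> ?J\<close> \<open>y \<in> ?J\<close> by blast
        have "x + y = e1 * (a + a') + e2 * (b + b') + e3 * (c + c')"
          by (simp add: xy algebra_simps)
        also have "\<dots> \<in> ?J" using abc by (intro J QI_add)
        finally show ?thesis by simp
      qed
    qed
    show r: "x \<otimes>\<^bsub>QI_ring m\<^esub> y \<in> ?J" if xy: "x \<in> ?J" "y \<in> carrier (QI_ring m)" for x y
    proof -
      obtain a b c where abc: "a \<in> QI m" "b \<in> QI m" "c \<in> QI m" and x: "x = e1 * a + e2 * b + e3 * c"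
        using xy(1) by blast
      have "x * y = e1 * (a * y) + e2 * (b * y) + e3 * (c * y)"
        by (simp add: x algebra_simps)
      also have "\<dots> \<in> ?J" using abc xy(2) by (intro J QI_mult) simp_all
      finally show ?thesis by simp
    qed
    show "y \<otimes>\<^bsub>QI_ring m\<^esub> x \<in> ?J" if "x \<in> ?J" "y \<in> carrier (QI_ring m)" for x y
      using r[OF that] by (simp add: mult.commute)
  qed
  moreover have "{e1, e2, e3} \<subseteq> ?J"
    using J[of 1 0 0] J[of 0 1 0] J[of 0 0 1] QI_0 QI_const[of 1 m] by simp
  ultimately show "e_ideal m \<subseteq> ?J"
    unfolding e_ideal_def by (rule genideal_minimal)
qed

lemma e_ideal_QI: "P \<in> e_ideal m \<Longrightarrow> P \<in> QI m"
  using elementary_in_QI[of m] by (auto simp: e_ideal_eq intro!: QI_add QI_mult)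

lemma e_ideal_0: "0 \<in> e_ideal m"
  using additive_subgroup.zero_closed[OF ideal.axioms(1)[OF ideal_e_ideal], of m] by simp

lemma e_ideal_add: "P \<in> e_ideal m \<Longrightarrow> Q \<in> e_ideal m \<Longrightarrow> P + Q \<in> e_ideal m"
  using additive_subgroup.a_closed[OF ideal.axioms(1)[OF ideal_e_ideal], of P m Q] by simp

lemma e_ideal_mult: "P \<in> e_ideal m \<Longrightarrow> Q \<in> QI m \<Longrightarrow> P * Q \<in> e_ideal m"
  using ideal.I_r_closed[OF ideal_e_ideal, of P m Q] by simp

text \<open>The averaged coefficients are symmetric and therefore quasiinvariant for every
  \<open>m\<close>.\<close>

lemma symmetric_ev0_e_ideal: "symmetric P \<Longrightarrow> ev0 P = 0 \<Longrightarrow> P \<in> e_ideal m"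
  using symmetric_in_elementary_ideal[of P] symmetric_QI unfolding e_ideal_eq by blast

section \<open>Linear algebra in the quotient\<close>

lemma img_eq_iff: "P \<in> QI m \<Longrightarrow> Q \<in> QI m \<Longrightarrow> img m P = img m Q \<longleftrightarrow> P - Q \<in> e_ideal m"
  using ring.quotient_eq_iff_same_a_r_cos[OF _ ideal_e_ideal, of m P Q] cring_QI_ring[of m]
  by (simp add: img_def cring_def QI_ring_minus)

lemma img_ring_hom: "img m \<in> ring_hom (QI_ring m) (QI_quot m)"
  unfolding img_def QI_quot_def by (rule ideal.rcos_ring_hom[OF ideal_e_ideal])

lemma img_add: "P \<in> QI m \<Longrightarrow> Q \<in> QI m \<Longrightarrow> img m P \<oplus>\<^bsub>QI_quot m\<^esub> img m Q = img m (P + Q)"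
  using ring_hom_add[OF img_ring_hom, of P m Q] by simp

lemma img_mult: "P \<in> QI m \<Longrightarrow> Q \<in> QI m \<Longrightarrow> img m P \<otimes>\<^bsub>QI_quot m\<^esub> img m Q = img m (P * Q)"
  using ring_hom_mult[OF img_ring_hom, of P m Q] by simp

lemma img_0: "\<zero>\<^bsub>QI_quot m\<^esub> = img m 0"
  using ring_hom_zero[OF img_ring_hom _ ring_QI_quot, of m] cring_QI_ring[of m] by (simp add: cring_def)

lemma carrier_QI_quot: "carrier (QI_quot m) = img m ` QI m"
  by (auto simp: QI_quot_def FactRing_def A_RCOSETS_def' img_def)

fun lincomb :: "rat list \<Rightarrow> poly3 list \<Rightarrow> poly3" where
  "lincomb (c # cs) (P # Ps) = const c * P + lincomb cs Ps"
| "lincomb _ _ = 0"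

lemma lincomb_QI: "set Ps \<subseteq> QI m \<Longrightarrow> lincomb cs Ps \<in> QI m"
  by (induction cs Ps rule: lincomb.induct) (auto intro!: QI_add QI_mult QI_const QI_0)

lemma Span_img:
  assumes "set Ps \<subseteq> QI m"
  shows "ring.Span (QI_quot m) (scalars m) (map (img m) Ps) =
    {img m (lincomb cs Ps) | cs. length cs = length Ps}"
  using assms
proof (induction Ps)
  case Nil
  then show ?case by (simp add: ring.Span.simps[OF ring_QI_quot] img_0)
next
  case (Cons P Ps)
  have "ring.Span (QI_quot m) (scalars m) (map (img m) (P # Ps)) =
      ring.line_extension (QI_quot m) (scalars m) (img m P) {img m (lincomb cs Ps) | cs. length cs = length Ps}"
    using Cons by (simp add: ring.Span.simps[OF ring_QI_quot])
  also have "\<dots> = {img m (const c * P + lincomb cs Ps) | c cs. length cs = length Ps}"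
  proof -
    have *: "img m (const c) \<otimes>\<^bsub>QI_quot m\<^esub> img m P \<oplus>\<^bsub>QI_quot m\<^esub> img m (lincomb cs Ps) =
        img m (const c * P + lincomb cs Ps)" for c cs
      using Cons.prems lincomb_QI[of Ps m cs] by (simp add: img_mult img_add QI_const QI_mult)
    show ?thesis
      by (rule Set.set_eqI) (unfold ring.line_extension_mem_iff[OF ring_QI_quot] scalars_def *[symmetric], blast)
  qed
  also have "\<dots> = {img m (lincomb cs (P # Ps)) | cs. length cs = length (P # Ps)}"
    by (auto simp: length_Suc_conv) (metis length_Cons lincomb.simps(1), blast)
  finally show ?case .
qed

lemma lincomb_uminus: "lincomb (map uminus cs) Ps = - lincomb cs Ps"
  by (induction cs Ps rule: lincomb.induct) (simp_all add: const_uminus)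

text \<open>The recursive notion of independence asks that each head lie outside the span of its
  tail. Otherwise there would be a relation with leading coefficient 1; relations among the tail are
  padded with 0.\<close>

lemma lin_indep_img:
  assumes "set Ps \<subseteq> QI m"
    and "\<And>cs. length cs = length Ps \<Longrightarrow> lincomb cs Ps \<in> e_ideal m \<Longrightarrow> set cs \<subseteq> {0}"
  shows "lin_indep m (map (img m) Ps)"
  using assms
proof (induction Ps)
  case Nil
  then show ?case by (simp add: lin_indep_def ring.li_Nil[OF ring_QI_quot])
next
  case (Cons P Ps)
  have "lin_indep m (map (img m) Ps)"
  proof (rule Cons.IH)
    fix cs assume "length cs = length Ps" "lincomb cs Ps \<in> e_ideal m"
    then show "set cs \<subseteq> {0}" using Cons.prems(2)[of "0 # cs"] by simp
  qed (use Cons.prems in simp)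
  moreover have "img m P \<notin> ring.Span (QI_quot m) (scalars m) (map (img m) Ps)"
  proof
    assume "img m P \<in> ring.Span (QI_quot m) (scalars m) (map (img m) Ps)"
    then obtain cs where cs: "length cs = length Ps" "img m P = img m (lincomb cs Ps)"
      using Cons.prems(1) by (auto simp: Span_img)
    then have "P - lincomb cs Ps \<in> e_ideal m"
      using Cons.prems(1) lincomb_QI[of Ps m cs] by (simp add: img_eq_iff)
    then show False
      using Cons.prems(2)[of "1 # map uminus cs"] cs(1) by (simp add: lincomb_uminus)
  qed
  moreover have "img m P \<in> carrier (QI_quot m)"
    using Cons.prems(1) by (simp add: carrier_QI_quot)
  ultimately show ?case
    by (simp add: lin_indep_def ring.li_Cons[OF ring_QI_quot])
qed

text \<open>A head in the ideal has class zero, which lies in every span. This extracts from the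
  independence hypotheses that \<open>A1\<close> and \<open>A2\<close> are nonzero in the
  quotient.\<close>

lemma lin_indep_hd_not_in_e_ideal:
  assumes "lin_indep m (map (img m) (P # Ps))" "set Ps \<subseteq> QI m"
  shows "P \<notin> e_ideal m"
proof
  assume P: "P \<in> e_ideal m"
  have "lincomb (replicate (length Ps) 0) Ps = 0"
    by (induction Ps) simp_all
  moreover have "img m P = img m 0" using P by (simp add: img_eq_iff e_ideal_QI QI_0)
  ultimately have "img m P \<in> ring.Span (QI_quot m) (scalars m) (map (img m) Ps)"
    unfolding Span_img[OF assms(2)] by (metis (mono_tags, lifting) length_replicate mem_Collect_eq)
  then show False
    using assms(1) ring.independent_backwards(1)[OF ring_QI_quot] by (simp add: lin_indep_def)
qed

section \<open>Freeness over the symmetric polynomials\<close>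

lemma const_third: "const (1 / 3) * (3 * P) = P"
  using const_inverse_mult[of 3 P] by (simp add: const_numeral)

text \<open>The summands are the isotypic projections. The two-dimensional representation is spanned
  by a vector fixed by \<open>s 2 3\<close> and its image under \<open>s 1 2\<close>, so two fixed
  elements \<open>M\<close> and \<open>N\<close> encode the standard part.\<close>

lemma QI_decomposition:
  assumes "P \<in> QI m"
  shows "\<exists>S T M N. symmetric S \<and> symmetric T \<and> std m M \<and> std m N \<and>
    P = S + \<Delta> ^ (2 * m + 1) * T + M + s 1 2 N"
proof -
  let ?k = "const (1 / 6)"
  define A where "A = ?k * (P - s 1 2 P - s 2 3 P + s 1 2 (s 2 3 P) + s 2 3 (s 1 2 P) - s 1 2 (s 2 3 (s 1 2 P)))"
  define M where "M = ?k * (2 * (P + s 2 3 P - s 1 2 (s 2 3 P) - s 1 2 (s 2 3 (s 1 2 P))))"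
  define N where "N = ?k * (2 * (s 1 2 P - s 1 2 (s 2 3 P) + s 2 3 (s 1 2 P) - s 1 2 (s 2 3 (s 1 2 P))))"
  note simps = s_mult s_const s_diff s_add s_numeral algebra_simps
  have two: "2 \<in> QI m" using QI_const[of 2 m] by (simp add: const_numeral)
  have QI: "A \<in> QI m" "M \<in> QI m" "N \<in> QI m"
    unfolding A_def M_def N_def by (intro QI_mult QI_const QI_add QI_diff QI_s_12 QI_s_23 assms two)+
  have alt: "s 1 2 A = - A" "s 2 3 A = - A"
    by (simp_all add: A_def simps)
  have "(var 1 - var 2) ^ (2 * m + 1) dvd A - s 1 2 A" using QI(1) by (simp add: QI_iff)
  \<comment> \<open>Since \<open>A\<close> is alternating, \<open>A - s 1 2 A\<close> is
    \<open>2 A\<close>, and 2 is a unit.\<close>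
  then have "(var 1 - var 2) ^ (2 * m + 1) dvd const (1 / 2) * (A - s 1 2 A)" by (rule dvd_mult)
  moreover have "const (1 / 2) * (A - s 1 2 A) = A"
    using const_inverse_mult[of 2 A] by (simp add: alt const_numeral)
  ultimately obtain T where T: "symmetric T" "A = \<Delta> ^ (2 * m + 1) * T"
    using alternating_eq_\<Delta>_power_mult[OF alt, of "2 * m + 1"] by auto
  have "std m M"
    by (rule std_QI[OF QI(2)]) (simp_all add: M_def simps)
  moreover have "std m N"
    by (rule std_QI[OF QI(3)]) (simp_all add: N_def simps)
  moreover have "P = reynolds P + A + M + s 1 2 N"
    by (subst const_sixth[of P, symmetric]) (simp add: reynolds_def A_def M_def N_def simps)
  ultimately show ?thesis using T symmetric_reynolds by blast
qed

text \<open>The relation is translated by all six group elements. The sum of the translates isolates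
  \<open>S\<close> and their signed sum isolates the alternating term; elimination among the rest
  leaves \<open>3 * Y\<close>.\<close>

lemma isotypic_components_independent:
  assumes "symmetric S" "symmetric T" "std m X" "std m Y"
    and eq: "S + \<Delta> ^ (2 * m + 1) * T + X + s 1 2 Y = 0"
  shows "S = 0" "T = 0" "X = 0" "Y = 0"
proof -
  define D where "D = \<Delta> ^ (2 * m + 1) * T"
  define x' y' where "x' = s 1 2 X" and "y' = s 1 2 Y"
  have S: "s 1 2 S = S" "s 2 3 S = S" using assms(1) by (simp_all add: symmetric_iff)
  have D: "s 1 2 D = - D" "s 2 3 D = - D"
    using assms(2) by (simp_all add: D_def symmetric_iff s_mult s_power s_\<Delta>)
  note X = std_s[OF assms(3)] and Y = std_s[OF assms(4)]
  have xy: "s 1 2 X = x'" "s 1 2 Y = y'" "s 1 2 x' = X" "s 1 2 y' = Y"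
    "s 2 3 x' = - X - x'" "s 2 3 y' = - Y - y'"
    using X Y by (simp_all add: x'_def y'_def)
  note simps = s_add s_diff s_uminus S D xy X(1) Y(1) s_0
  have 1: "S + D + X + y' = 0" using eq by (simp add: D_def y'_def)
  have 2: "S - D + x' + Y = 0" using arg_cong[OF 1, of "s 1 2"] by (simp add: simps)
  have 3: "S - D + X + (- Y - y') = 0" using arg_cong[OF 1, of "s 2 3"] by (simp add: simps)
  have 4: "S + D + (- X - x') + Y = 0" using arg_cong[OF 2, of "s 2 3"] by (simp add: simps)
  have 5: "S + D + x' + (- y' - Y) = 0" using arg_cong[OF 3, of "s 1 2"] by (simp add: simps algebra_simps)
  have 6: "S - D + (- x' - X) + y' = 0" using arg_cong[OF 4, of "s 1 2"] by (simp add: simps algebra_simps)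
  have "6 * S = (S + D + X + y') + (S - D + x' + Y) + (S - D + X + (- Y - y'))
      + (S + D + (- X - x') + Y) + (S + D + x' + (- y' - Y)) + (S - D + (- x' - X) + y')"
    by (simp add: algebra_simps)
  then show S0: "S = 0" by (simp add: 1 2 3 4 5 6)
  have "6 * D = (S + D + X + y') - (S - D + x' + Y) - (S - D + X + (- Y - y'))
      + (S + D + (- X - x') + Y) + (S + D + x' + (- y' - Y)) - (S - D + (- x' - X) + y')"
    by (simp add: algebra_simps)
  then have D0: "D = 0" by (simp add: 1 2 3 4 5 6)
  then show "T = 0" by (simp add: D_def \<Delta>_nonzero)
  have XY: "X + y' = 0" "x' + Y = 0" "X + (- Y - y') = 0" "x' + (- y' - Y) = 0"
    using 1 2 3 5 by (simp_all only: S0 D0 add_0_left diff_zero)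
  have "3 * Y = (x' + Y) * 2 - (X + y') + (X + (- Y - y')) - 2 * (x' + (- y' - Y))"
    by (simp add: algebra_simps)
  also have "\<dots> = 0" unfolding XY by simp
  finally show Y0: "Y = 0" by simp
  show "X = 0" using 1 by (simp add: S0 D0 y'_def Y0 s_0)
qed

lemma \<Delta>_power_QI: "\<Delta> ^ (2 * m + 1) \<in> QI m"
proof -
  define D where "D = \<Delta> ^ (2 * m + 1)"
  have s12: "s 1 2 D = - D" and s23: "s 2 3 D = - D"
    by (simp_all add: D_def s_power s_mult s_\<Delta>)
  then have s13: "s 1 3 D = - D" by (simp add: s_13 s_uminus)
  have "(var 1 - var 2) ^ (2 * m + 1) dvd D" "(var 1 - var 3) ^ (2 * m + 1) dvd D"
    "(var 2 - var 3) ^ (2 * m + 1) dvd D"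
    unfolding D_def by (rule dvd_power_same; simp add: \<Delta>_def)+
  then show ?thesis
    unfolding QI_iff D_def[symmetric] s12 s13 s23 diff_minus_eq_add by (intro conjI dvd_add)
qed

lemma length_6: "length cs = 6 \<Longrightarrow> \<exists>c0 c1 c2 c3 c4 c5. cs = [c0, c1, c2, c3, c4, c5]"
  by (simp add: eval_nat_numeral length_Suc_conv) blast

section \<open>The free basis attached to a pair with nonzero constant determinant\<close>

locale std_basis =
  fixes m :: nat and B1 B2 :: poly3 and d :: rat
  assumes std: "std m B1" "std m B2"
    and QI: "B1 \<in> QI m" "B2 \<in> QI m"
    and wronski: "wronski B1 B2 = \<Delta> ^ (2 * m + 1) * const d" and d: "d \<noteq> 0"
begin

text \<open>In Cramer's rule all three determinants carry the same power of \<Delta>. It cancels,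
  and the remaining divisor \<open>d\<close> is a nonzero rational.\<close>

lemma std_repr:
  assumes "std m P"
  shows "\<exists>a b. symmetric a \<and> symmetric b \<and> P = a * B1 + b * B2"
proof -
  obtain a where a: "symmetric a" "wronski P B2 = \<Delta> ^ (2 * m + 1) * a"
    using wronski_eq[OF assms std(2)] by blast
  obtain b where b: "symmetric b" "wronski B1 P = \<Delta> ^ (2 * m + 1) * b"
    using wronski_eq[OF std(1) assms] by blast
  have "\<Delta> ^ (2 * m + 1) * (const d * P) = \<Delta> ^ (2 * m + 1) * (a * B1 + b * B2)"
    using wronski_cramer[of B1 B2 P] unfolding wronski a b by (simp add: algebra_simps)
  then have "const d * P = a * B1 + b * B2" using \<Delta>_nonzero by simp
  then have "P = const (1 / d) * (a * B1 + b * B2)"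
    using const_inverse_mult[OF d, of P] by simp
  then have "P = (const (1 / d) * a) * B1 + (const (1 / d) * b) * B2"
    by (simp add: algebra_simps)
  then show ?thesis using a(1) b(1) symmetric_mult[OF symmetric_const] by blast
qed

lemma std_mult_add:
  assumes "symmetric a" "symmetric b"
  shows "std m (a * B1 + b * B2)"
proof (rule std_QI)
  show "a * B1 + b * B2 \<in> QI m"
    using assms QI by (simp add: QI_add QI_mult symmetric_QI)
  have ab: "s 1 2 a = a" "s 2 3 a = a" "s 1 2 b = b" "s 2 3 b = b"
    using assms by (simp_all add: symmetric_iff)
  show "s 2 3 (a * B1 + b * B2) = a * B1 + b * B2"
    by (simp add: s_add s_mult ab std_s[OF std(1)] std_s[OF std(2)])
  show "a * B1 + b * B2 + s 1 2 (a * B1 + b * B2) + s 2 3 (s 1 2 (a * B1 + b * B2)) = 0"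
    by (simp add: s_add s_mult ab std_s[OF std(1)] std_s[OF std(2)] algebra_simps)
qed

text \<open>Applying \<open>s 1 2\<close> to the relation gives a second linear equation; the
  determinant of the system is nonzero.\<close>

lemma std_free:
  assumes "symmetric a" "symmetric b" "a * B1 + b * B2 = 0"
  shows "a = 0" "b = 0"
proof -
  have "s 1 2 (a * B1 + b * B2) = 0" unfolding assms(3) by (rule s_0)
  then have "a * s 1 2 B1 + b * s 1 2 B2 = 0"
    using assms(1,2) by (simp only: s_add s_mult symmetric_iff)
  note eq = assms(3) this
  have "a * wronski B1 B2 = (a * B1 + b * B2) * s 1 2 B2 - (a * s 1 2 B1 + b * s 1 2 B2) * B2"
    by (simp add: wronski_def algebra_simps)
  then show "a = 0" using \<Delta>_nonzero d by (simp add: eq wronski)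
  have "b * wronski B1 B2 = (a * s 1 2 B1 + b * s 1 2 B2) * B1 - (a * B1 + b * B2) * s 1 2 B1"
    by (simp add: wronski_def algebra_simps)
  then show "b = 0" using \<Delta>_nonzero d by (simp add: eq wronski)
qed

definition comb :: "poly3 \<Rightarrow> poly3 \<Rightarrow> poly3 \<Rightarrow> poly3 \<Rightarrow> poly3 \<Rightarrow> poly3 \<Rightarrow> poly3" where
  "comb p0 p1 p2 p3 p4 p5 = p0 + p1 * B1 + p2 * s 1 2 B1 + p3 * B2 + p4 * s 1 2 B2 + p5 * \<Delta> ^ (2 * m + 1)"

lemma QI_repr:
  assumes "P \<in> QI m"
  shows "\<exists>p0 p1 p2 p3 p4 p5. symmetric p0 \<and> symmetric p1 \<and> symmetric p2 \<and> symmetric p3 \<and>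
    symmetric p4 \<and> symmetric p5 \<and> P = comb p0 p1 p2 p3 p4 p5"
proof -
  obtain S T M N where P: "symmetric S" "symmetric T" "std m M" "std m N"
    "P = S + \<Delta> ^ (2 * m + 1) * T + M + s 1 2 N"
    using QI_decomposition[OF assms] by blast
  obtain p1 p3 where M: "symmetric p1" "symmetric p3" "M = p1 * B1 + p3 * B2"
    using std_repr[OF P(3)] by blast
  obtain p2 p4 where N: "symmetric p2" "symmetric p4" "N = p2 * B1 + p4 * B2"
    using std_repr[OF P(4)] by blast
  have "s 1 2 N = p2 * s 1 2 B1 + p4 * s 1 2 B2"
    using N(1,2) by (simp add: N(3) s_add s_mult symmetric_iff)
  then have "P = comb S p1 p2 p3 p4 T"
    by (simp add: P(5) M(3) comb_def algebra_simps)
  then show ?thesis using P(1,2) M(1,2) N(1,2) by blast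
qed

lemma comb_free:
  assumes sym: "symmetric p0" "symmetric p1" "symmetric p2" "symmetric p3" "symmetric p4" "symmetric p5"
    and "comb p0 p1 p2 p3 p4 p5 = 0"
  shows "p0 = 0 \<and> p1 = 0 \<and> p2 = 0 \<and> p3 = 0 \<and> p4 = 0 \<and> p5 = 0"
proof -
  have "s 1 2 (p2 * B1 + p4 * B2) = p2 * s 1 2 B1 + p4 * s 1 2 B2"
    using sym by (simp add: s_add s_mult symmetric_iff)
  then have "p0 + \<Delta> ^ (2 * m + 1) * p5 + (p1 * B1 + p3 * B2) + s 1 2 (p2 * B1 + p4 * B2) = 0"
    using assms(7) by (simp add: comb_def algebra_simps)
  note * = isotypic_components_independent[OF sym(1,6) std_mult_add[OF sym(2,4)] std_mult_add[OF sym(3,5)] this]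
  show ?thesis
    using *(1,2) std_free[OF sym(2,4) *(3)] std_free[OF sym(3,5) *(4)] by simp
qed

lemma comb_add: "comb p0 p1 p2 p3 p4 p5 + comb q0 q1 q2 q3 q4 q5 =
    comb (p0 + q0) (p1 + q1) (p2 + q2) (p3 + q3) (p4 + q4) (p5 + q5)"
  and comb_diff: "comb p0 p1 p2 p3 p4 p5 - comb q0 q1 q2 q3 q4 q5 =
    comb (p0 - q0) (p1 - q1) (p2 - q2) (p3 - q3) (p4 - q4) (p5 - q5)"
  and comb_mult: "e * comb p0 p1 p2 p3 p4 p5 =
    comb (e * p0) (e * p1) (e * p2) (e * p3) (e * p4) (e * p5)"
  by (simp_all add: comb_def algebra_simps)

text \<open>An element of the ideal is a combination of the \<open>e_i\<close> with quasiinvariant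
  coefficients. Expanding those over the six generators multiplies each coordinate by some
  \<open>e_i\<close>, which kills its constant term.\<close>

lemma e_ideal_repr:
  assumes "P \<in> e_ideal m"
  shows "\<exists>p0 p1 p2 p3 p4 p5. (\<forall>p\<in>{p0, p1, p2, p3, p4, p5}. symmetric p \<and> ev0 p = 0) \<and>
    P = comb p0 p1 p2 p3 p4 p5"
proof -
  let ?R = "\<lambda>P. \<exists>p0 p1 p2 p3 p4 p5. (\<forall>p\<in>{p0, p1, p2, p3, p4, p5}. symmetric p \<and> ev0 p = 0) \<and>
    P = comb p0 p1 p2 p3 p4 p5"
  have add: "?R (P + Q)" if PQ: "?R P" "?R Q" for P Q
  proof -
    obtain p0 p1 p2 p3 p4 p5 where p: "\<forall>p\<in>{p0, p1, p2, p3, p4, p5}. symmetric p \<and> ev0 p = 0"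
      "P = comb p0 p1 p2 p3 p4 p5" using PQ(1) by blast
    obtain q0 q1 q2 q3 q4 q5 where q: "\<forall>p\<in>{q0, q1, q2, q3, q4, q5}. symmetric p \<and> ev0 p = 0"
      "Q = comb q0 q1 q2 q3 q4 q5" using PQ(2) by blast
    show ?thesis
      unfolding p(2) q(2) comb_add
      by (intro exI, rule conjI[OF _ refl])
        (use p(1) q(1) in \<open>simp add: symmetric_add ring_hom1D[OF ring_hom1_ev0]\<close>)
  qed
  have mult: "?R (e * P)" if P: "P \<in> QI m" and e: "symmetric e" "ev0 e = 0" for e P
  proof -
    obtain p0 p1 p2 p3 p4 p5 where p: "symmetric p0" "symmetric p1" "symmetric p2" "symmetric p3"
      "symmetric p4" "symmetric p5" "P = comb p0 p1 p2 p3 p4 p5" using QI_repr[OF P] by blast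
    show ?thesis
      unfolding p(7) comb_mult
      by (intro exI, rule conjI[OF _ refl]) (simp add: p e symmetric_mult ring_hom1D[OF ring_hom1_ev0])
  qed
  have "ev0 e1 = 0" "ev0 e2 = 0" "ev0 e3 = 0"
    by (simp_all add: e1_def e2_def e3_def ring_hom1D[OF ring_hom1_ev0] ev0_var)
  moreover obtain a b c where "a \<in> QI m" "b \<in> QI m" "c \<in> QI m" "P = e1 * a + e2 * b + e3 * c"
    using assms unfolding e_ideal_eq by blast
  ultimately show ?thesis
    using symmetric_elementary by (simp only:) (intro add mult)
qed

definition basis :: "poly3 list" where
  "basis = [1, B1, s 1 2 B1, B2, s 1 2 B2, \<Delta> ^ (2 * m + 1)]"

lemma basis_QI: "set basis \<subseteq> QI m"
  using QI QI_const[of 1 m] \<Delta>_power_QI[of m] by (simp add: basis_def QI_s_12)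

lemma lincomb_basis:
  "lincomb [c0, c1, c2, c3, c4, c5] basis = comb (const c0) (const c1) (const c2) (const c3) (const c4) (const c5)"
  by (simp add: basis_def comb_def)

text \<open>By freeness, the constants of a relation modulo the ideal coincide with coordinates
  without constant term, hence vanish.\<close>

lemma lin_indep_basis: "lin_indep m (map (img m) basis)"
proof (rule lin_indep_img[OF basis_QI])
  fix cs assume cs: "length cs = length basis" "lincomb cs basis \<in> e_ideal m"
  then obtain c0 c1 c2 c3 c4 c5 where c: "cs = [c0, c1, c2, c3, c4, c5]"
    using length_6[of cs] by (auto simp: basis_def)
  obtain p0 p1 p2 p3 p4 p5 where p: "\<forall>p\<in>{p0, p1, p2, p3, p4, p5}. symmetric p \<and> ev0 p = 0"
    "lincomb cs basis = comb p0 p1 p2 p3 p4 p5"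
    using e_ideal_repr[OF cs(2)] by blast
  have "comb (const c0 - p0) (const c1 - p1) (const c2 - p2) (const c3 - p3) (const c4 - p4) (const c5 - p5) = 0"
    using p(2) unfolding c lincomb_basis comb_diff[symmetric] by simp
  from comb_free[OF _ _ _ _ _ _ this] have "const c0 = p0" "const c1 = p1" "const c2 = p2" "const c3 = p3"
    "const c4 = p4" "const c5 = p5"
    using p(1) by (simp_all add: symmetric_diff symmetric_const)
  then have "const c = 0" if "c \<in> set cs" for c
    using p(1) that ev0_const[of c] unfolding c by auto
  then show "set cs \<subseteq> {0}" by auto
qed

text \<open>Replacing each symmetric coordinate by its constant term changes the element only within
  the ideal.\<close>

lemma Span_basis: "ring.Span (QI_quot m) (scalars m) (map (img m) basis) = carrier (QI_quot m)"
proof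
  show "ring.Span (QI_quot m) (scalars m) (map (img m) basis) \<subseteq> carrier (QI_quot m)"
    unfolding Span_img[OF basis_QI] carrier_QI_quot using lincomb_QI[OF basis_QI] by blast
  have "\<exists>cs. length cs = length basis \<and> img m P = img m (lincomb cs basis)" if P: "P \<in> QI m" for P
  proof -
    obtain p0 p1 p2 p3 p4 p5 where p: "symmetric p0" "symmetric p1" "symmetric p2" "symmetric p3"
      "symmetric p4" "symmetric p5" "P = comb p0 p1 p2 p3 p4 p5" using QI_repr[OF P] by blast
    obtain c0 c1 c2 c3 c4 c5 where c: "ev0 p0 = const c0" "ev0 p1 = const c1" "ev0 p2 = const c2"
      "ev0 p3 = const c3" "ev0 p4 = const c4" "ev0 p5 = const c5"
      using ev0_range by metis
    have e: "q - const c \<in> e_ideal m" if "symmetric q" "ev0 q = const c" for q c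
      using that by (intro symmetric_ev0_e_ideal)
        (simp_all add: symmetric_diff symmetric_const ring_hom1D[OF ring_hom1_ev0] ev0_const)
    have "comb (p0 - const c0) (p1 - const c1) (p2 - const c2) (p3 - const c3) (p4 - const c4) (p5 - const c5) \<in> e_ideal m"
      unfolding comb_def using basis_QI
      by (intro e_ideal_add e_ideal_mult e p c) (simp_all add: basis_def)
    then have "P - lincomb [c0, c1, c2, c3, c4, c5] basis \<in> e_ideal m"
      by (simp only: p(7) lincomb_basis comb_diff)
    then have "img m P = img m (lincomb [c0, c1, c2, c3, c4, c5] basis)"
      using P lincomb_QI[OF basis_QI] by (simp add: img_eq_iff)
    moreover have "length [c0, c1, c2, c3, c4, c5] = length basis" by (simp add: basis_def)
    ultimately show ?thesis by blast
  qed
  then show "carrier (QI_quot m) \<subseteq> ring.Span (QI_quot m) (scalars m) (map (img m) basis)"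
    unfolding Span_img[OF basis_QI] carrier_QI_quot by blast
qed

lemma is_basis_basis: "is_basis m (map (img m) basis)"
  by (simp only: is_basis_def lin_indep_basis Span_basis)

end

lemma graded_cong: "graded a P \<Longrightarrow> a = b \<Longrightarrow> graded b P"
  by simp

text \<open>Comparison with the generators given by the integrals: in degrees \<open>3m + 1\<close> and \<open>3m + 2\<close> Cramer's
  rule leaves only constant coefficients and one of degree \<open>1\<close>, which lies in the ideal.\<close>

lemma wronski_of_generators:
  assumes std: "std m B1" "std m B2" and QI: "B1 \<in> QI m" "B2 \<in> QI m"
    and graded: "graded (3 * m + 1) B1" "graded (3 * m + 2) B2"
    and notin: "B1 \<notin> e_ideal m" "B2 \<notin> e_ideal m"
  shows "\<exists>d. d \<noteq> 0 \<and> wronski B1 B2 = \<Delta> ^ (2 * m + 1) * const d"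
proof -
  define F1 F2 where "F1 = std_gen m 0" and "F2 = std_gen m 1"
  have F: "std m F1" "std m F2" "graded (3 * m + 1) F1" "graded (3 * m + 2) F2"
    using std_std_gen graded_std_gen[of m 0] graded_std_gen[of m 1] by (simp_all add: F1_def F2_def)
  let ?D = "\<Delta> ^ (2 * m + 1)"
  have D: "graded (6 * m + 3) ?D" "?D \<noteq> 0"
    using graded_power[OF graded_\<Delta>, of "2 * m + 1"] \<Delta>_nonzero by (simp_all add: algebra_simps)
  obtain T where T: "wronski F1 F2 = ?D * T" using wronski_eq[OF F(1,2)] by blast
  have "graded (6 * m + 3 + 0) (?D * T)"
    by (rule graded_cong[OF graded_wronski[OF F(3,4), unfolded T]]) simp
  from graded_cancel[OF D(1) this D(2)] obtain c where c: "T = const c" using graded_0_const by blast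
  have "c \<noteq> 0" using wronski_std_gen_nonzero[of m] T c by (auto simp: F1_def F2_def)
  obtain U where U: "wronski B1 F2 = ?D * U" using wronski_eq[OF std(1) F(2)] by blast
  have "graded (6 * m + 3 + 0) (?D * U)"
    by (rule graded_cong[OF graded_wronski[OF graded(1) F(4), unfolded U]]) simp
  from graded_cancel[OF D(1) this D(2)] obtain u where u: "U = const u" using graded_0_const by blast
  obtain V where V: "wronski F1 B1 = ?D * V" using wronski_eq[OF F(1) std(1)] by blast
  \<comment> \<open>Two elements of degree \<open>3m + 1\<close> have a determinant of degree
    \<open>6m + 2\<close>, too small for a nonzero multiple of \<open>\<Delta>^(2m+1)\<close>. So
    \<open>B1\<close> is proportional to \<open>F1\<close>.\<close>
  have "graded (6 * m + 2) (?D * V)"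
    by (rule graded_cong[OF graded_wronski[OF F(3) graded(1), unfolded V]]) simp
  from graded_cancel_less[OF D(1) this D(2)] have "V = 0" by simp
  then have "?D * (const c * B1) = ?D * (const u * F1)"
    using wronski_cramer[of F1 F2 B1] by (simp add: T U V c u algebra_simps)
  then have B1: "const c * B1 = const u * F1" using D(2) by simp
  have "u \<noteq> 0" using B1 \<open>c \<noteq> 0\<close> notin(1) e_ideal_0 by auto
  obtain U2 where U2: "symmetric U2" "wronski B2 F2 = ?D * U2" using wronski_eq[OF std(2) F(2)] by blast
  have "graded (6 * m + 3 + 1) (?D * U2)"
    by (rule graded_cong[OF graded_wronski[OF graded(2) F(4), unfolded U2(2)]]) simp
  from graded_cancel[OF D(1) this D(2)] have "ev0 U2 = 0" by (rule graded_pos_ev0) simp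
  then have U2_ideal: "U2 \<in> e_ideal m" using U2(1) by (rule symmetric_ev0_e_ideal[rotated])
  obtain V2 where V2: "wronski F1 B2 = ?D * V2" using wronski_eq[OF F(1) std(2)] by blast
  have "graded (6 * m + 3 + 0) (?D * V2)"
    by (rule graded_cong[OF graded_wronski[OF F(3) graded(2), unfolded V2]]) simp
  from graded_cancel[OF D(1) this D(2)] obtain v where v: "V2 = const v" using graded_0_const by blast
  have "?D * (const c * B2) = ?D * (U2 * F1 + const v * F2)"
    using wronski_cramer[of F1 F2 B2] by (simp add: T U2 V2 c v algebra_simps)
  then have B2: "const c * B2 = U2 * F1 + const v * F2" using D(2) by simp
  \<comment> \<open>Proportionality to \<open>B1\<close> makes \<open>F1\<close> quasiinvariant, so
    that for \<open>v = 0\<close> the multiple \<open>U2 * F1\<close> would put \<open>B2\<close>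
    into the ideal.\<close>
  have "F1 = const (1 / u) * (const c * B1)"
    unfolding B1 using const_inverse_mult[OF \<open>u \<noteq> 0\<close>] by simp
  then have F1_QI: "F1 \<in> QI m" using QI by (simp add: QI_mult QI_const)
  have "v \<noteq> 0"
  proof
    assume "v = 0"
    then have "B2 = U2 * F1 * const (1 / c)"
      using B2 const_inverse_mult[OF \<open>c \<noteq> 0\<close>, of B2] by (simp add: mult.commute)
    also have "\<dots> \<in> e_ideal m" by (intro e_ideal_mult U2_ideal F1_QI QI_const)
    finally show False using notin(2) by simp
  qed
  \<comment> \<open>The passage from \<open>F1, F2\<close> to \<open>B1, B2\<close> is triangular up
    to the factor \<open>c\<close>. The symmetric \<open>U2\<close> commutes with
    \<open>s 1 2\<close>, so its term contributes a multiple of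
    \<open>wronski F1 F1 = 0\<close>.\<close>
  have "const c * (const c * wronski B1 B2) = wronski (const c * B1) (const c * B2)"
    by (simp add: wronski_def s_mult s_const algebra_simps)
  also have "\<dots> = const u * const v * wronski F1 F2"
    using U2(1) unfolding B1 B2 by (simp add: wronski_def s_mult s_const s_add symmetric_iff algebra_simps)
  also have "\<dots> = const c * (?D * const (u * v))"
    by (simp add: T c const_mult ac_simps)
  finally have "const c * wronski B1 B2 = ?D * const (u * v)" using \<open>c \<noteq> 0\<close> by simp
  then have "wronski B1 B2 = const (1 / c) * (?D * const (u * v))"
    using const_inverse_mult[OF \<open>c \<noteq> 0\<close>, of "wronski B1 B2"] by simp
  also have "\<dots> = ?D * const (1 / c * (u * v))" by (simp only: const_mult ac_simps)
  finally show ?thesis using \<open>c \<noteq> 0\<close> \<open>u \<noteq> 0\<close> \<open>v \<noteq> 0\<close> by (metis divide_eq_0_iff mult_eq_0_iff zero_neq_one)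
qed

text \<open>For \<open>A\<close> fixed by \<open>s 2 3\<close>, the average \<open>S\<close> of its
  three conjugates is symmetric of positive degree, hence in the ideal. Subtracting it keeps the
  classes of \<open>A\<close> and \<open>s 1 2 A\<close> and makes the orbit sum vanish.\<close>

lemma std_part:
  assumes A: "A \<in> QI m" "s 2 3 A = A" "graded n A" "n > 0"
  shows "\<exists>B. std m B \<and> B \<in> QI m \<and> graded n B \<and> A - B \<in> e_ideal m \<and> s 1 2 A - s 1 2 B \<in> e_ideal m"
proof -
  define S where "S = const (1 / 3) * (A + s 1 2 A + s 2 3 (s 1 2 A))"
  have aba: "s 1 2 (s 2 3 (s 1 2 A)) = s 2 3 (s 1 2 A)"
    using s_braid[of A] by (simp add: A(2))
  have sym: "symmetric S"
    by (simp add: S_def symmetric_iff s_mult s_const s_add A(2) aba ac_simps)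
  have "graded n S"
    unfolding S_def by (intro graded_const_mult graded_add graded_s A(3))
  then have ideal: "S \<in> e_ideal m" using sym graded_pos_ev0 A(4) symmetric_ev0_e_ideal by blast
  have QI: "A - S \<in> QI m" using A(1) symmetric_QI[OF sym] by (rule QI_diff)
  have "3 * S = A + s 1 2 A + s 2 3 (s 1 2 A)"
    unfolding S_def mult.left_commute[of 3] by (rule const_third)
  then have "std m (A - S)"
    using sym by (intro std_QI[OF QI]) (simp_all add: s_diff symmetric_iff A(2) algebra_simps)
  moreover have "graded n (A - S)" using A(3) \<open>graded n S\<close> by (rule graded_diff)
  moreover have "A - (A - S) \<in> e_ideal m" "s 1 2 A - s 1 2 (A - S) \<in> e_ideal m"
    using ideal sym by (simp_all add: s_diff symmetric_iff)
  ultimately show ?thesis using QI by blast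
qed

theorem theorem3:
  fixes m :: nat and A1 A2 :: poly3 and C C' :: "nat \<Rightarrow> nat \<Rightarrow> rat"
  assumes "A1 \<in> QI m" and "\<not> symmetric A1" and "homogeneous (3 * m + 1) A1"
    and "A1 = (\<Sum>(i, j)\<in>{(i, j). i \<le> j \<and> j \<le> m}.
                 const (C i j) * var 1 ^ (3 * m + 1 - i - j) * msym i j)"
    and "s 2 3 A1 = A1"
    and "lin_indep m [img m A1, img m (s 1 2 A1), img m (\<Delta> ^ (2 * m + 1))]"
    and "A2 \<in> QI m" and "\<not> symmetric A2" and "homogeneous (3 * m + 2) A2"
    and "A2 = (\<Sum>(i, j)\<in>{(i, j). i \<le> j \<and> j \<le> m}.
                 const (C' i j) * var 1 ^ (3 * m + 2 - i - j) * msym i j)"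
    and "s 2 3 A2 = A2"
    and "lin_indep m [img m A2, img m (s 1 2 A2), img m (\<Delta> ^ (2 * m + 1))]"
  shows "is_basis m [img m 1, img m A1, img m (s 1 2 A1),
                     img m A2, img m (s 1 2 A2), img m (\<Delta> ^ (2 * m + 1))]"
proof -
  obtain B1 where B1: "std m B1" "B1 \<in> QI m" "graded (3 * m + 1) B1"
    "A1 - B1 \<in> e_ideal m" "s 1 2 A1 - s 1 2 B1 \<in> e_ideal m"
    using std_part[OF assms(1,5) homogeneous_graded[OF assms(3)]] by auto
  obtain B2 where B2: "std m B2" "B2 \<in> QI m" "graded (3 * m + 2) B2"
    "A2 - B2 \<in> e_ideal m" "s 1 2 A2 - s 1 2 B2 \<in> e_ideal m"
    using std_part[OF assms(7,11) homogeneous_graded[OF assms(9)]] by auto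
  have notin: "A \<notin> e_ideal m"
    if "lin_indep m [img m A, img m (s 1 2 A), img m (\<Delta> ^ (2 * m + 1))]" "A \<in> QI m" for A
    using lin_indep_hd_not_in_e_ideal[of m A "[s 1 2 A, \<Delta> ^ (2 * m + 1)]"] that \<Delta>_power_QI
    by (simp add: QI_s_12)
  have "B1 \<notin> e_ideal m" "B2 \<notin> e_ideal m"
    using notin[OF assms(6,1)] notin[OF assms(12,7)] e_ideal_add[OF B1(4), of B1] e_ideal_add[OF B2(4), of B2] by auto
  then obtain d where d: "d \<noteq> 0" "wronski B1 B2 = \<Delta> ^ (2 * m + 1) * const d"
    using wronski_of_generators[OF B1(1) B2(1) B1(2) B2(2) B1(3) B2(3)] by blast
  interpret std_basis m B1 B2 d
    by unfold_locales (fact B1 B2 d)+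
  \<comment> \<open>The classes of the given elements agree with those of their standard parts, so
    the basis found for the latter is the required one.\<close>
  have "img m A1 = img m B1" "img m (s 1 2 A1) = img m (s 1 2 B1)"
    "img m A2 = img m B2" "img m (s 1 2 A2) = img m (s 1 2 B2)"
    using assms(1,7) B1 B2 by (simp_all add: img_eq_iff QI_s_12)
  then show ?thesis
    using is_basis_basis by (simp add: basis_def)
qed

end
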